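(* Let $U:\mathbb{R}^d\to\mathbb{R}$ be continuously differentiable, and let $L\ge 0$, $m>0$ be such that for all $x,y\in\mathbb{R}^d$, $\|\nabla U(x)-\nabla U(y)\|\le L\|x-y\|$ and $U(y)\ge U(x)+\langle\nabla U(x),y-x\rangle+(m/2)\|x-y\|^2$. Let $(\gamma_k)_{k\ge1}$ be a non-increasing sequence of positive real numbers with $\gamma_1\le 1/(m+L)$, $\lim_{k\to\infty}\gamma_k=0$ and $\lim_{n\to+\infty}\sum_{k=1}^n\gamma_k=+\infty$. Then for all $x\in\mathbb{R}^d$, $\lim_{n\to\infty}W_2(\delta_xQ_\gamma^n,\pi)=0$.
   Context: Here $d\ge1$. $\pi$ is the probability measure on $\mathbb{R}^d$ with density proportional to $e^{-U}$. For $\gamma>0$, $R_\gamma$ is the Markov kernel on $\mathbb{R}^d$ such that $R_\gamma(x,\cdot)$ is the Gaussian distribution with mean $x-\gamma\nabla U(x)$ and covariance matrix $2\gamma I_d$. $Q_\gamma^n=R_{\gamma_1}R_{\gamma_2}\cdots R_{\gamma_n}$. $W_2$ is the Wasserstein distance of order $2$ associated with the Euclidean distance. *)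

theory Defs
  imports "HOL-Probability.Probability"
begin

text \<open>The Gaussian distribution with mean \<open>m\<close> and invertible covariance matrix \<open>S\<close>; the density is
  meaningful only for symmetric positive definite \<open>S\<close>.\<close>

definition gaussian_measure :: "real ^ 'n \<Rightarrow> real ^ 'n ^ 'n \<Rightarrow> (real ^ 'n) measure" where
  "gaussian_measure m S = density lborel (\<lambda>y. ennreal
     (exp (- ((y - m) \<bullet> (matrix_inv S *v (y - m))) / 2) / sqrt ((2 * pi) ^ CARD('n) * det S)))"

text \<open>If \<open>exp (- U)\<close> has infinite integral, division in \<open>ennreal\<close> makes this the null measure.\<close>

definition gibbs_measure :: "(real ^ 'n \<Rightarrow> real) \<Rightarrow> (real ^ 'n) measure" where
  "gibbs_measure U = density lborel
     (\<lambda>x. ennreal (exp (- U x)) / (\<integral>\<^sup>+ y. ennreal (exp (- U y)) \<partial>lborel))"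

text \<open>A Markov kernel on a space is a map from points to measures. Both the action of a kernel
  on a measure, \<open>(\<mu>K)(A) = \<integral> K(x,A) \<mu>(dx)\<close>, and the composition of kernels,
  \<open>(K\<^sub>1K\<^sub>2)(x,A) = \<integral> K\<^sub>2(y,A) K\<^sub>1(x,dy)\<close>, are instances of the Giry bind.\<close>

definition kernel_comp :: "('a \<Rightarrow> 'a measure) \<Rightarrow> ('a \<Rightarrow> 'a measure) \<Rightarrow> 'a \<Rightarrow> 'a measure" where
  "kernel_comp K\<^sub>1 K\<^sub>2 = (\<lambda>x. K\<^sub>1 x \<bind> K\<^sub>2)"

definition euler_kernel :: "(real ^ 'n \<Rightarrow> real ^ 'n) \<Rightarrow> real \<Rightarrow> real ^ 'n \<Rightarrow> (real ^ 'n) measure" where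
  "euler_kernel gradU g = (\<lambda>x. gaussian_measure (x - g *\<^sub>R gradU x) (mat (2 * g)))"

text \<open>Step sizes are indexed from 1; \<open>\<gamma> 0\<close> is never used.\<close>

primrec euler_iter :: "(real ^ 'n \<Rightarrow> real ^ 'n) \<Rightarrow> (nat \<Rightarrow> real) \<Rightarrow> nat \<Rightarrow> real ^ 'n \<Rightarrow> (real ^ 'n) measure"
where
  "euler_iter gradU \<gamma> 0 = return borel"
| "euler_iter gradU \<gamma> (Suc n) =
     kernel_comp (euler_iter gradU \<gamma> n) (euler_kernel gradU (\<gamma> (Suc n)))"

definition couplings :: "'a::topological_space measure \<Rightarrow> 'a measure \<Rightarrow> ('a \<times> 'a) measure set" where
  "couplings \<mu> \<nu> = {\<zeta> \<in> space (prob_algebra (borel \<Otimes>\<^sub>M borel)).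
     distr \<zeta> borel fst = \<mu> \<and> distr \<zeta> borel snd = \<nu>}"

definition ennreal_sqrt :: "ennreal \<Rightarrow> ennreal" where
  "ennreal_sqrt a = (if a = \<infinity> then \<infinity> else ennreal (sqrt (enn2real a)))"

text \<open>The value is \<open>\<infinity>\<close> if no coupling has finite transport cost, in particular if \<open>\<mu>\<close> or \<open>\<nu>\<close> is
  not a probability measure.\<close>

definition wasserstein2 :: "'a::metric_space measure \<Rightarrow> 'a measure \<Rightarrow> ennreal" where
  "wasserstein2 \<mu> \<nu> = ennreal_sqrt
     (INF \<zeta>\<in>couplings \<mu> \<nu>. \<integral>\<^sup>+ z. ennreal ((dist (fst z) (snd z))\<^sup>2) \<partial>\<zeta>)"

end

theory Submission
  imports Defs
begin

text \<open>The Langevin diffusion is replaced by its Metropolis-adjusted discretisation. Let \<open>X\<close> be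
  distributed according to \<open>\<pi>\<close>, let \<open>Y\<close> be an Euler step of size \<open>g\<close> from \<open>X\<close>, and let \<open>X'\<close> be \<open>Y\<close> if \<open>Y\<close>
  is accepted by the Metropolis rule and \<open>X\<close> otherwise; then \<open>X'\<close> is again distributed according to \<open>\<pi>\<close>.
  An Euler step from \<open>V\<close> driven by the same Gaussian increment ends at \<open>Y + D\<close>, where \<open>D\<close> is the
  difference of the two gradient steps and \<open>\<bar>D\<bar>\<^sup>2 \<le> (1 - m g) \<bar>V - X\<bar>\<^sup>2\<close> for small \<open>g\<close>.
  Since \<open>Y - X\<close> has order \<open>sqrt g\<close> and the rejection probability has order \<open>g\<close>, rejections cost
  \<open>O(g\<^sup>2)\<close> in mean square; the cross term with \<open>D\<close> is absorbed by half of the contraction. Hence the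
  squared distances satisfy \<open>a (n + 1) \<le> (1 - m g / 2) a n + K g\<^sup>2\<close> with \<open>g = \<gamma> (n + 1)\<close>, and such sequences
  tend to \<open>0\<close> because the step sizes tend to \<open>0\<close> and have infinite sum.\<close>

section \<open>Gaussian integrals\<close>

text \<open>The integrand factorises over the coordinates, and each factor is a multiple of the
  one-dimensional normal density of variance \<open>s\<close>.\<close>

lemma nn_integral_exp_norm_sq:
  fixes s :: real
  assumes "0 < s"
  shows "(\<integral>\<^sup>+ x. ennreal (exp (- (norm x)\<^sup>2 / (2 * s))) \<partial>(lborel :: 'a::euclidean_space measure))
    = ennreal (sqrt ((2 * pi * s) ^ DIM('a)))"
proof -
  have one: "(\<integral>\<^sup>+ t. ennreal (exp (- t\<^sup>2 / (2 * s))) \<partial>lborel) = ennreal (sqrt (2 * pi * s))"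
  proof -
    have pt: "ennreal (exp (- t\<^sup>2 / (2 * s)))
      = ennreal (sqrt (2 * pi * s)) * ennreal (normal_density 0 (sqrt s) t)" for t
      using assms by (simp add: normal_density_def ennreal_mult[symmetric] real_sqrt_mult)
    have "emeasure (density lborel (normal_density 0 (sqrt s))) UNIV = 1"
      using prob_space.emeasure_space_1[OF prob_space_normal_density[of "sqrt s" 0]] assms by simp
    then have "(\<integral>\<^sup>+ t. ennreal (normal_density 0 (sqrt s) t) \<partial>lborel) = 1"
      by (simp add: emeasure_density)
    then show ?thesis
      unfolding pt by (subst nn_integral_cmult) auto
  qed
  have "ennreal (exp (- (norm x)\<^sup>2 / (2 * s))) = (\<Prod>b\<in>Basis. ennreal (exp (- (x \<bullet> b)\<^sup>2 / (2 * s))))"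
    for x :: 'a
  proof -
    have "(norm x)\<^sup>2 = (\<Sum>b\<in>Basis. (x \<bullet> b)\<^sup>2)"
      unfolding power2_norm_eq_inner by (subst euclidean_inner) (simp add: power2_eq_square)
    then have "- (norm x)\<^sup>2 / (2 * s) = (\<Sum>b\<in>Basis. - (x \<bullet> b)\<^sup>2 / (2 * s))"
      by (simp add: sum_negf sum_divide_distrib)
    then show ?thesis by (simp add: exp_sum prod_ennreal)
  qed
  then have "(\<integral>\<^sup>+ x. ennreal (exp (- (norm x)\<^sup>2 / (2 * s))) \<partial>(lborel :: 'a measure))
    = (\<Prod>b\<in>(Basis::'a set). \<integral>\<^sup>+ t. ennreal (exp (- t\<^sup>2 / (2 * s))) \<partial>lborel)"
    using nn_integral_lborel_prod[of "\<lambda>(b::'a) t. ennreal (exp (- t\<^sup>2 / (2 * s)))"] by simp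
  also have "\<dots> = ennreal (sqrt ((2 * pi * s) ^ DIM('a)))"
    unfolding one using assms by (simp add: ennreal_power real_sqrt_power)
  finally show ?thesis .
qed

text \<open>Half of the exponent absorbs the polynomial: with
  \<open>t = (norm x)\<^sup>2 / (4 * s)\<close> the bound \<open>t ^ 3 \<le> 6 * exp t\<close>
  leaves a Gaussian of variance \<open>2 * s\<close>. The power six is the degree of
  \<open>local_error\<close> in the size of a step.\<close>

lemma nn_integral_norm_power6_exp_finite:
  fixes s :: real
  assumes "0 < s"
  shows "(\<integral>\<^sup>+ x. ennreal (norm x ^ 6 * exp (- (norm x)\<^sup>2 / (2 * s)))
    \<partial>(lborel :: 'a::euclidean_space measure)) < \<infinity>"
proof -
  have pt: "norm x ^ 6 * exp (- (norm x)\<^sup>2 / (2 * s))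
    \<le> (6 * (4 * s) ^ 3) * exp (- (norm x)\<^sup>2 / (2 * (2 * s)))" for x :: 'a
  proof -
    define t where "t = (norm x)\<^sup>2 / (4 * s)"
    have t0: "t \<ge> 0" using assms by (simp add: t_def)
    have "t ^ 3 / fact 3 \<le> exp t"
    proof -
      have "(\<Sum>n\<in>{3}. t ^ n /\<^sub>R fact n) \<le> (\<Sum>n. t ^ n /\<^sub>R fact n)"
        using t0 by (intro sum_le_suminf summable_exp_generic) auto
      then show ?thesis by (simp add: exp_def divide_simps)
    qed
    then have "t ^ 3 \<le> 6 * exp t" by (simp add: fact_numeral)
    moreover have "norm x ^ 6 = (4 * s) ^ 3 * t ^ 3"
      using assms by (simp add: t_def power_divide power_mult_distrib field_simps flip: power_mult)
    ultimately have "norm x ^ 6 \<le> (4 * s) ^ 3 * (6 * exp t)"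
      using assms by simp
    then have "norm x ^ 6 * exp (- 2 * t) \<le> (4 * s) ^ 3 * (6 * exp t) * exp (- 2 * t)"
      by (intro mult_right_mono) auto
    also have "\<dots> = 6 * (4 * s) ^ 3 * exp (- t)"
      by (simp add: mult.assoc flip: exp_add)
    finally show ?thesis by (simp add: t_def)
  qed
  have "(\<integral>\<^sup>+ x. ennreal (norm x ^ 6 * exp (- (norm x)\<^sup>2 / (2 * s))) \<partial>(lborel :: 'a measure))
    \<le> (\<integral>\<^sup>+ x. ennreal (6 * (4 * s) ^ 3) * ennreal (exp (- (norm x)\<^sup>2 / (2 * (2 * s))))
      \<partial>(lborel :: 'a measure))"
    using pt assms by (intro nn_integral_mono) (simp add: ennreal_mult[symmetric] ennreal_leI)
  also have "\<dots> < \<infinity>"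
    using nn_integral_exp_norm_sq[of "2 * s", where 'a='a] assms
    by (subst nn_integral_cmult) (auto simp: ennreal_mult_less_top)
  finally show ?thesis .
qed

section \<open>Isotropic Gaussian measures\<close>

definition gauss_density :: "real \<Rightarrow> real ^ 'n \<Rightarrow> real" where
  "gauss_density s h = exp (- (norm h)\<^sup>2 / (2 * s)) / sqrt ((2 * pi * s) ^ CARD('n))"

lemma gauss_density_pos: "0 < s \<Longrightarrow> 0 < gauss_density s h"
  by (simp add: gauss_density_def)

lemma borel_measurable_gauss_density [measurable]: "gauss_density s \<in> borel_measurable borel"
  unfolding gauss_density_def by measurable

text \<open>The matrix \<open>mat s\<close> acts as multiplication by \<open>s\<close>, so its
  inverse is division by \<open>s\<close> and its determinant is a power of \<open>s\<close>. This
  removes matrices from all later computations.\<close>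

lemma gaussian_measure_scalar:
  fixes c :: "real ^ 'n"
  assumes "0 < s"
  shows "gaussian_measure c (mat s) = density lborel (\<lambda>y. ennreal (gauss_density s (y - c)))"
proof -
  have mat_mult: "mat s *v z = s *\<^sub>R z" for z :: "real ^ 'n"
    by (vector matrix_vector_mult_def mat_def)
      (simp add: if_distrib if_distribR cong del: if_weak_cong)
  have det_mat: "det (mat s :: real ^ 'n ^ 'n) = s ^ CARD('n)"
    by (simp add: det_diagonal mat_def)
  \<comment> \<open>\<open>matrix_inv\<close> is a Hilbert choice, so it inverts only once some
    two-sided inverse is known to exist; the nonzero determinant provides one.\<close>
  have "\<exists>B. (mat s :: real ^ 'n ^ 'n) ** B = mat 1 \<and> B ** mat s = mat 1"
    using assms det_mat invertible_det_nz[of "mat s :: real ^ 'n ^ 'n"] by (simp add: invertible_def)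
  then have inv: "(mat s :: real ^ 'n ^ 'n) ** matrix_inv (mat s) = mat 1"
    unfolding matrix_inv_def by (rule someI2_ex) blast
  have "matrix_inv (mat s) *v z = (1 / s) *\<^sub>R z" for z :: "real ^ 'n"
  proof -
    have "s *\<^sub>R (matrix_inv (mat s) *v z) = z"
      using mat_mult[of "matrix_inv (mat s) *v z"] inv by (simp add: matrix_vector_mul_assoc)
    then have "(1 / s) *\<^sub>R (s *\<^sub>R (matrix_inv (mat s) *v z)) = (1 / s) *\<^sub>R z" by simp
    then show ?thesis using assms by simp
  qed
  then show ?thesis
    using assms
    by (simp add: gaussian_measure_def gauss_density_def det_mat power2_norm_eq_inner
        power_mult_distrib mult.commute[of 2 s])
qed

lemma prob_space_gaussian_measure_scalar:
  fixes c :: "real ^ 'n"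
  assumes "0 < s"
  shows "prob_space (gaussian_measure c (mat s))"
proof
  have "(\<integral>\<^sup>+ y. ennreal (gauss_density s (y - c)) \<partial>lborel)
    = (\<integral>\<^sup>+ y. ennreal (gauss_density s y) \<partial>(lborel :: (real ^ 'n) measure))"
    by (subst (2) lborel_affine[of 1 "- c"]) (simp_all add: nn_integral_density nn_integral_distr)
  also have "\<dots> = (\<integral>\<^sup>+ y. ennreal (1 / sqrt ((2 * pi * s) ^ CARD('n)))
      * ennreal (exp (- (norm y)\<^sup>2 / (2 * s))) \<partial>(lborel :: (real ^ 'n) measure))"
    using assms by (simp add: gauss_density_def ennreal_mult[symmetric])
  also have "\<dots> = 1"
    using assms
    by (subst nn_integral_cmult, measurable, subst nn_integral_exp_norm_sq)
      (simp_all add: ennreal_mult[symmetric])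
  finally show "emeasure (gaussian_measure c (mat s)) (space (gaussian_measure c (mat s))) = 1"
    using assms by (simp add: gaussian_measure_scalar emeasure_density)
qed

abbreviation std_gaussian :: "(real ^ 'n) measure" where
  "std_gaussian \<equiv> gaussian_measure 0 (mat 1)"

lemma sets_gaussian_measure [simp, measurable_cong]: "sets (gaussian_measure c S) = sets borel"
  by (simp add: gaussian_measure_def)

lemma space_gaussian_measure [simp]: "space (gaussian_measure c S) = UNIV"
  by (simp add: gaussian_measure_def)

lemma prob_space_std_gaussian: "prob_space (std_gaussian :: (real ^ 'n) measure)"
  by (rule prob_space_gaussian_measure_scalar) simp

text \<open>Change of variables in the density. Writing every transition as an image of one standard
  Gaussian is what lets two chains share their increments.\<close>

lemma gaussian_measure_affine:
  fixes c :: "real ^ 'n"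
  assumes "0 < s"
  shows "gaussian_measure c (mat s) = distr std_gaussian borel (\<lambda>w. c + sqrt s *\<^sub>R w)"
proof -
  let ?F = "\<lambda>w::real ^ 'n. c + sqrt s *\<^sub>R w"
  have dens: "gauss_density s (?F w - c) * sqrt s ^ CARD('n) = gauss_density 1 w" for w
    using assms by (simp add: gauss_density_def power_mult_distrib real_sqrt_mult real_sqrt_power)
  have "gaussian_measure c (mat s) = density (density (distr lborel borel ?F)
      (\<lambda>_. ennreal (sqrt s ^ CARD('n)))) (\<lambda>y. ennreal (gauss_density s (y - c)))"
    using assms lborel_affine[of "sqrt s" c] by (simp add: gaussian_measure_scalar)
  also have "\<dots> = density (distr lborel borel ?F)
      (\<lambda>y. ennreal (sqrt s ^ CARD('n)) * ennreal (gauss_density s (y - c)))"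
    by (subst density_density_eq) auto
  also have "\<dots> = distr (density lborel
      (\<lambda>w. ennreal (sqrt s ^ CARD('n)) * ennreal (gauss_density s (?F w - c)))) borel ?F"
    by (subst density_distr) auto
  also have "\<dots> = distr std_gaussian borel ?F"
    using assms dens
    by (simp add: gaussian_measure_scalar ennreal_mult[symmetric] gauss_density_pos less_imp_le mult.commute)
  finally show ?thesis .
qed

lemma std_gaussian_norm_power6_finite:
  "(\<integral>\<^sup>+ w. ennreal (norm w ^ 6) \<partial>(std_gaussian :: (real ^ 'n) measure)) < \<infinity>"
proof -
  have "(\<integral>\<^sup>+ w. ennreal (norm w ^ 6) \<partial>(std_gaussian :: (real ^ 'n) measure))
    = (\<integral>\<^sup>+ w. ennreal (1 / sqrt ((2 * pi) ^ CARD('n)))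
        * ennreal (norm w ^ 6 * exp (- (norm w)\<^sup>2 / (2 * 1))) \<partial>(lborel :: (real ^ 'n) measure))"
    by (simp add: gaussian_measure_scalar nn_integral_density gauss_density_def ennreal_mult[symmetric]
        mult.commute)
  also have "\<dots> < \<infinity>"
    using nn_integral_norm_power6_exp_finite[of 1, where 'a="real ^ 'n"]
    by (subst nn_integral_cmult) (auto simp: ennreal_mult_less_top)
  finally show ?thesis .
qed

text \<open>Here \<open>r x y\<close> is the joint density of the current state and the
  proposal, and the accepted part \<open>min (r x y) (r y x)\<close> of it is symmetric.\<close>

lemma nn_integral_metropolis:
  fixes r :: "'a \<Rightarrow> 'a \<Rightarrow> real" and f :: "'a \<Rightarrow> ennreal"
  assumes M: "sigma_finite_measure M"
    and r [measurable]: "case_prod r \<in> borel_measurable (M \<Otimes>\<^sub>M M)"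
    and f [measurable]: "f \<in> borel_measurable M"
    and r_pos: "\<And>x y. 0 < r x y"
  shows "(\<integral>\<^sup>+ x. \<integral>\<^sup>+ y. ennreal (r x y) * (ennreal (min 1 (r y x / r x y)) * f y
      + ennreal (1 - min 1 (r y x / r x y)) * f x) \<partial>M \<partial>M)
    = (\<integral>\<^sup>+ x. \<integral>\<^sup>+ y. ennreal (r x y) * f x \<partial>M \<partial>M)"
proof -
  interpret sigma_finite_measure M by (rule M)
  interpret MM: pair_sigma_finite M M by standard
  define s where "s x y = min (r x y) (r y x)" for x y
  have [measurable]: "(\<lambda>(x, y). s x y) \<in> borel_measurable (M \<Otimes>\<^sub>M M)"
    unfolding s_def by measurable
  have s: "0 \<le> s x y" "s x y \<le> r x y" for x y
    using r_pos[of x y] r_pos[of y x] by (auto simp: s_def)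
  have acc: "r x y * min 1 (r y x / r x y) = s x y" for x y
    using r_pos[of x y] by (auto simp: s_def min_def field_simps)
  have pt: "ennreal (r x y) * (ennreal (min 1 (r y x / r x y)) * f y
      + ennreal (1 - min 1 (r y x / r x y)) * f x)
    = ennreal (s x y) * f y + ennreal (r x y - s x y) * f x" for x y
  proof -
    have "r x y * (1 - min 1 (r y x / r x y)) = r x y - s x y"
      using acc[of x y] by (simp add: algebra_simps)
    then show ?thesis
      using r_pos[of x y] r_pos[of y x] acc[of x y]
      by (simp add: distrib_left mult.assoc[symmetric] ennreal_mult[symmetric])
  qed
  have swap: "(\<integral>\<^sup>+ x. \<integral>\<^sup>+ y. ennreal (s x y) * f y \<partial>M \<partial>M) = (\<integral>\<^sup>+ x. \<integral>\<^sup>+ y. ennreal (s x y) * f x \<partial>M \<partial>M)"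
  proof -
    have "(\<integral>\<^sup>+ x. \<integral>\<^sup>+ y. ennreal (s x y) * f y \<partial>M \<partial>M) = (\<integral>\<^sup>+ y. \<integral>\<^sup>+ x. ennreal (s x y) * f y \<partial>M \<partial>M)"
      by (rule MM.Fubini'[symmetric]) measurable
    also have "\<dots> = (\<integral>\<^sup>+ y. \<integral>\<^sup>+ x. ennreal (s y x) * f y \<partial>M \<partial>M)"
      by (simp add: s_def min.commute)
    finally show ?thesis .
  qed
  have "(\<integral>\<^sup>+ x. \<integral>\<^sup>+ y. ennreal (s x y) * f y + ennreal (r x y - s x y) * f x \<partial>M \<partial>M)
    = (\<integral>\<^sup>+ x. (\<integral>\<^sup>+ y. ennreal (s x y) * f y \<partial>M) + (\<integral>\<^sup>+ y. ennreal (r x y - s x y) * f x \<partial>M) \<partial>M)"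
    by (intro nn_integral_cong nn_integral_add) measurable
  also have "\<dots> = (\<integral>\<^sup>+ x. \<integral>\<^sup>+ y. ennreal (s x y) * f x \<partial>M \<partial>M)
      + (\<integral>\<^sup>+ x. \<integral>\<^sup>+ y. ennreal (r x y - s x y) * f x \<partial>M \<partial>M)"
    unfolding swap[symmetric] by (intro nn_integral_add) measurable
  also have "\<dots> = (\<integral>\<^sup>+ x. (\<integral>\<^sup>+ y. ennreal (s x y) * f x \<partial>M) + (\<integral>\<^sup>+ y. ennreal (r x y - s x y) * f x \<partial>M) \<partial>M)"
    by (intro nn_integral_add[symmetric]) measurable
  also have "\<dots> = (\<integral>\<^sup>+ x. \<integral>\<^sup>+ y. ennreal (s x y) * f x + ennreal (r x y - s x y) * f x \<partial>M \<partial>M)"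
    by (intro nn_integral_cong nn_integral_add[symmetric]) measurable
  also have "\<dots> = (\<integral>\<^sup>+ x. \<integral>\<^sup>+ y. ennreal (r x y) * f x \<partial>M \<partial>M)"
    using s by (simp add: distrib_right[symmetric] ennreal_plus[symmetric] del: ennreal_plus)
  finally show ?thesis unfolding pt .
qed

section \<open>Perturbed contractions and elementary estimates\<close>

text \<open>Once \<open>K * t (Suc n) < c * d\<close>, the perturbation is dominated by the
  contraction at level \<open>d\<close>, so the excess \<open>a n - d\<close> shrinks by the factor
  \<open>1 - c * t (Suc n) \<le> exp (- c * t (Suc n))\<close>. The product of these factors tends
  to 0 because the sum of the steps diverges. Assumptions from \<open>N\<close> on suffice, which
  later leaves room for large initial steps.\<close>

lemma perturbed_contraction_tendsto_0:
  fixes a t :: "nat \<Rightarrow> real"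
  assumes nonneg: "\<And>n. 0 \<le> a n"
    and step: "\<And>n. N \<le> n \<Longrightarrow> a (Suc n) \<le> (1 - c * t (Suc n)) * a n + K * (t (Suc n))\<^sup>2"
    and c_pos: "0 < c" and K_nonneg: "0 \<le> K"
    and t_pos: "\<And>n. 0 < t (Suc n)"
    and ct: "\<And>n. N \<le> n \<Longrightarrow> c * t (Suc n) \<le> 1"
    and t_lim: "t \<longlonglongrightarrow> 0"
    and t_sum: "filterlim (\<lambda>n. \<Sum>k=1..n. t k) at_top sequentially"
  shows "a \<longlonglongrightarrow> 0"
proof (rule LIMSEQ_I)
  fix e :: real assume "0 < e"
  define d where "d = e / 2"
  have d: "0 < d" using \<open>0 < e\<close> by (simp add: d_def)
  have "(\<lambda>n. K * t (Suc n)) \<longlonglongrightarrow> K * 0"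
    by (intro tendsto_mult tendsto_const LIMSEQ_Suc t_lim)
  then have "\<forall>\<^sub>F n in sequentially. K * t (Suc n) < c * d"
    using c_pos d by (intro order_tendstoD(2)) auto
  then obtain M0 where M0: "\<And>n. M0 \<le> n \<Longrightarrow> K * t (Suc n) < c * d"
    by (auto simp: eventually_sequentially)
  define M where "M = max N M0"
  define S where "S n = (\<Sum>k=1..n. t k)" for n
  have contr: "a (Suc n) - d \<le> (1 - c * t (Suc n)) * (a n - d)" if "M \<le> n" for n
  proof -
    have "K * t (Suc n) * t (Suc n) \<le> c * d * t (Suc n)"
      using M0[of n] t_pos[of n] that by (intro mult_right_mono) (auto simp: M_def)
    with step[of n] that show ?thesis by (simp add: M_def algebra_simps power2_eq_square)
  qed
  \<comment> \<open>The absolute value keeps the right-hand side nonnegative, as the passage from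
    \<open>1 - c * t (Suc n)\<close> to the exponential requires; the excess itself may be
    negative.\<close>
  have bound: "a n - d \<le> exp (- c * (S n - S M)) * \<bar>a M - d\<bar>" if "M \<le> n" for n
    using that
  proof (induction n rule: dec_induct)
    case (step n)
    have "0 \<le> 1 - c * t (Suc n)" using ct[of n] step.hyps by (auto simp: M_def)
    then have "a (Suc n) - d \<le> (1 - c * t (Suc n)) * (exp (- c * (S n - S M)) * \<bar>a M - d\<bar>)"
      using contr[of n] step by (meson mult_left_mono order_trans)
    also have "\<dots> \<le> exp (- c * t (Suc n)) * (exp (- c * (S n - S M)) * \<bar>a M - d\<bar>)"
      using exp_ge_add_one_self[of "- c * t (Suc n)"] by (intro mult_right_mono) auto
    also have "\<dots> = exp (- c * (S (Suc n) - S M)) * \<bar>a M - d\<bar>"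
      by (simp add: S_def mult.assoc[symmetric] algebra_simps flip: exp_add)
    finally show ?case .
  qed simp
  have "filterlim (\<lambda>n. - S M + S n) at_top sequentially"
    unfolding S_def by (intro filterlim_tendsto_add_at_top[OF tendsto_const] t_sum)
  then have "filterlim (\<lambda>n. c * (- S M + S n)) at_top sequentially"
    using c_pos by (intro filterlim_tendsto_pos_mult_at_top[OF tendsto_const])
  then have "filterlim (\<lambda>n. - (c * (- S M + S n))) at_bot sequentially"
    by (simp add: filterlim_uminus_at_bot)
  then have "(\<lambda>n. exp (- (c * (- S M + S n)))) \<longlonglongrightarrow> 0"
    by (rule filterlim_compose[OF exp_at_bot])
  then have "(\<lambda>n. exp (- c * (S n - S M)) * \<bar>a M - d\<bar>) \<longlonglongrightarrow> 0"
    by (intro tendsto_mult_left_zero) (simp add: algebra_simps)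
  then have "\<forall>\<^sub>F n in sequentially. exp (- c * (S n - S M)) * \<bar>a M - d\<bar> < d"
    using d by (intro order_tendstoD(2))
  then obtain M1 where M1: "\<And>n. M1 \<le> n \<Longrightarrow> exp (- c * (S n - S M)) * \<bar>a M - d\<bar> < d"
    by (auto simp: eventually_sequentially)
  show "\<exists>no. \<forall>n\<ge>no. norm (a n - 0) < e"
  proof (intro exI allI impI)
    fix n assume "max M M1 \<le> n"
    then show "norm (a n - 0) < e"
      using bound[of n] M1[of n] nonneg[of n] by (simp add: d_def)
  qed
qed

lemma power6_add_le:
  fixes a b :: real
  assumes "0 \<le> a" "0 \<le> b"
  shows "(a + b) ^ 6 \<le> 64 * (a ^ 6 + b ^ 6)"
proof -
  have "(a + b) ^ 6 \<le> (2 * max a b) ^ 6"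
    using assms by (intro power_mono) auto
  also have "\<dots> = 64 * max a b ^ 6" by (simp add: power_mult_distrib)
  also have "max a b ^ 6 \<le> a ^ 6 + b ^ 6" using assms by (simp add: max_def)
  finally show ?thesis by simp
qed

text \<open>A uniform variable is at most \<open>a\<close> with probability \<open>a\<close>; this
  turns the acceptance test into a mixture of its two outcomes.\<close>

lemma nn_integral_uniform_threshold:
  fixes a :: real and A B :: ennreal
  assumes "0 \<le> a" "a \<le> 1"
  shows "(\<integral>\<^sup>+ u. (if u \<le> a then A else B) \<partial>uniform_measure lborel {0..1}) = ennreal a * A + ennreal (1 - a) * B"
proof -
  have "(\<integral>\<^sup>+ u. (if u \<le> a then A else B) \<partial>uniform_measure lborel {0..1})
    = (\<integral>\<^sup>+ u. A * indicator {0..a} u + B * indicator {a<..1} u \<partial>lborel)"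
    using assms by (subst nn_integral_uniform_measure)
      (auto intro!: nn_integral_cong simp: divide_ennreal_def split: split_indicator)
  also have "\<dots> = A * ennreal a + B * ennreal (1 - a)"
    using assms by (subst nn_integral_add) (auto simp: nn_integral_cmult_indicator)
  finally show ?thesis by (simp add: mult.commute)
qed

section \<open>Euler steps and their Metropolis acceptance probability\<close>

locale strongly_convex_potential =
  fixes U :: "real ^ 'n \<Rightarrow> real" and gradU :: "real ^ 'n \<Rightarrow> real ^ 'n" and L m :: real
  assumes U_continuous: "continuous_on UNIV U"
    and gradU_continuous: "continuous_on UNIV gradU"
    and L_nonneg: "0 \<le> L"
    and m_pos: "0 < m"
    and Lipschitz: "norm (gradU x - gradU y) \<le> L * norm (x - y)"
    and strong_convexity: "U y \<ge> U x + gradU x \<bullet> (y - x) + (m / 2) * (norm (x - y))\<^sup>2"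
begin

lemma borel_measurable_U [measurable]: "U \<in> borel_measurable borel"
  using U_continuous by (rule borel_measurable_continuous_onI)

lemma borel_measurable_gradU [measurable]: "gradU \<in> borel_measurable borel"
  using gradU_continuous by (rule borel_measurable_continuous_onI)

text \<open>The increment \<open>w\<close> is a separate argument so that two chains can be driven
  by the same one.\<close>

definition euler_step :: "real \<Rightarrow> real ^ 'n \<Rightarrow> real ^ 'n \<Rightarrow> real ^ 'n" where
  "euler_step g x w = x - g *\<^sub>R gradU x + sqrt (2 * g) *\<^sub>R w"

lemma borel_measurable_euler_step [measurable (raw)]:
  assumes [measurable]: "f \<in> borel_measurable M" "h \<in> borel_measurable M"
  shows "(\<lambda>z. euler_step g (f z) (h z)) \<in> borel_measurable M"
  unfolding euler_step_def by measurable

lemma euler_kernel_eq_distr: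
  "0 < g \<Longrightarrow> euler_kernel gradU g x = distr std_gaussian borel (euler_step g x)"
  unfolding euler_kernel_def euler_step_def by (rule gaussian_measure_affine) simp

lemma measurable_euler_kernel:
  assumes "0 < g"
  shows "euler_kernel gradU g \<in> borel \<rightarrow>\<^sub>M prob_algebra borel"
proof -
  have "(\<lambda>x. distr std_gaussian borel (euler_step g x)) \<in> borel \<rightarrow>\<^sub>M prob_algebra borel"
    by (intro measurable_distr_prob_space2[where M = borel] measurable_const)
      (auto simp: space_prob_algebra prob_space_std_gaussian case_prod_beta)
  moreover have "euler_kernel gradU g = (\<lambda>x. distr std_gaussian borel (euler_step g x))"
    using assms by (intro ext euler_kernel_eq_distr)
  ultimately show ?thesis by simp
qed

text \<open>Passes from increments to positions: the Metropolis rule compares densities with respect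
  to Lebesgue measure.\<close>

lemma nn_integral_euler_step:
  assumes "0 < g" and [measurable]: "f \<in> borel_measurable borel"
  shows "(\<integral>\<^sup>+ w. f (euler_step g x w) \<partial>std_gaussian)
    = (\<integral>\<^sup>+ y. ennreal (gauss_density (2 * g) (y - (x - g *\<^sub>R gradU x))) * f y \<partial>lborel)"
proof -
  have "(\<integral>\<^sup>+ w. f (euler_step g x w) \<partial>std_gaussian) = (\<integral>\<^sup>+ y. f y \<partial>euler_kernel gradU g x)"
    using assms(1) by (simp add: euler_kernel_eq_distr nn_integral_distr)
  then show ?thesis
    using assms(1) by (simp add: euler_kernel_def gaussian_measure_scalar nn_integral_density)
qed

text \<open>The logarithm of the Metropolis-Hastings ratio for the target proportional to
  \<open>exp (- U)\<close> and the Euler proposal of covariance \<open>2 * g\<close>; the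
  normalising constants cancel.\<close>

definition log_accept :: "real \<Rightarrow> real ^ 'n \<Rightarrow> real ^ 'n \<Rightarrow> real" where
  "log_accept g x y = U x - U y
    + ((norm (y - (x - g *\<^sub>R gradU x)))\<^sup>2 - (norm (x - (y - g *\<^sub>R gradU y)))\<^sup>2) / (4 * g)"

definition accept :: "real \<Rightarrow> real ^ 'n \<Rightarrow> real ^ 'n \<Rightarrow> real" where
  "accept g x y = min 1 (exp (log_accept g x y))"

lemma borel_measurable_accept [measurable (raw)]:
  assumes [measurable]: "f \<in> borel_measurable M" "h \<in> borel_measurable M"
  shows "(\<lambda>z. accept g (f z) (h z)) \<in> borel_measurable M"
  unfolding accept_def log_accept_def by measurable

lemma accept_bounds: "0 \<le> accept g x y" "accept g x y \<le> 1"
  by (auto simp: accept_def)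

lemma reject_le: "1 - accept g x y \<le> \<bar>log_accept g x y\<bar>"
proof -
  have "1 + log_accept g x y \<le> exp (log_accept g x y)" by (rule exp_ge_add_one_self)
  moreover have "1 - accept g x y = max 0 (1 - exp (log_accept g x y))" by (simp add: accept_def)
  ultimately show ?thesis by linarith
qed

section \<open>Pathwise estimates for one step\<close>

text \<open>Bounds the length of an Euler step divided by \<open>sqrt g\<close>, uniformly over all
  admissible \<open>g\<close>: the drift contributes \<open>sqrt g * norm (gradU x)\<close>, and
  \<open>sqrt g \<le> sqrt (1 / (m + L))\<close>.\<close>

definition amplitude :: "real ^ 'n \<Rightarrow> real ^ 'n \<Rightarrow> real" where
  "amplitude x w = sqrt (1 / (m + L)) * norm (gradU x) + sqrt 2 * norm w"

lemma amplitude_nonneg: "0 \<le> amplitude x w"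
  using L_nonneg m_pos by (simp add: amplitude_def)

text \<open>The coefficient of \<open>g\<^sup>2\<close> in the cost of rejections. The sixth power
  comes from splitting the cross term, the fourth from the squared length of the rejected
  step.\<close>

definition local_error :: "real ^ 'n \<Rightarrow> real ^ 'n \<Rightarrow> real" where
  "local_error x w = (8 * L\<^sup>2 / m) * amplitude x w ^ 6 + 2 * L * amplitude x w ^ 4"

context
  fixes g :: real
  assumes g_pos: "0 < g" and g_le: "g \<le> 1 / (m + L)"
begin

lemma drift_le: "g * norm (gradU x) \<le> sqrt g * (sqrt (1 / (m + L)) * norm (gradU x))"
proof -
  have "g = sqrt g * sqrt g" using g_pos by simp
  also have "\<dots> \<le> sqrt g * sqrt (1 / (m + L))"
    using g_pos g_le by (intro mult_left_mono real_sqrt_le_mono) auto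
  finally show ?thesis
    by (metis mult.assoc mult_right_mono norm_ge_zero)
qed

lemma drift_le_amplitude: "g * norm (gradU x) \<le> sqrt g * amplitude x w"
  using drift_le[of x] g_pos by (simp add: amplitude_def distrib_left add_increasing2)

lemma norm_euler_step_diff_le: "norm (euler_step g x w - x) \<le> sqrt g * amplitude x w"
proof -
  have "norm (euler_step g x w - x) = norm (sqrt (2 * g) *\<^sub>R w - g *\<^sub>R gradU x)"
    by (simp add: euler_step_def algebra_simps)
  also have "\<dots> \<le> sqrt (2 * g) * norm w + g * norm (gradU x)"
    using g_pos norm_triangle_ineq4[of "sqrt (2 * g) *\<^sub>R w" "g *\<^sub>R gradU x"] by simp
  also have "\<dots> \<le> sqrt g * amplitude x w"
    using drift_le[of x] by (simp add: amplitude_def real_sqrt_mult algebra_simps)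
  finally show ?thesis .
qed

text \<open>The contributions of order \<open>sqrt g\<close> cancel. What remains is the trapezoidal
  error of \<open>U\<close> along the step and \<open>g / 4\<close> times a difference of squared
  gradient norms; both are at most a multiple of \<open>g\<close> times the squared
  amplitude.\<close>

lemma log_accept_le: "\<bar>log_accept g x (euler_step g x w)\<bar> \<le> 2 * L * g * (amplitude x w)\<^sup>2"
proof -
  define y where "y = euler_step g x w"
  define h where "h = y - x"
  define A where "A = amplitude x w"
  have A: "0 \<le> A" by (simp add: A_def amplitude_nonneg)
  have h_le: "norm h \<le> sqrt g * A"
    using norm_euler_step_diff_le by (simp add: h_def y_def A_def)
  have h_sq: "(norm h)\<^sup>2 \<le> g * A\<^sup>2"
    using power_mono[OF h_le, of 2] g_pos by (simp add: power_mult_distrib)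
  have grad_diff: "norm (gradU y - gradU x) \<le> L * norm h"
    using Lipschitz[of y x] by (simp add: h_def)
  \<comment> \<open>The error of the trapezoidal rule for \<open>U y - U x\<close>.\<close>
  define T where "T = U x - U y + h \<bullet> (gradU x + gradU y) / 2"
  have eq: "log_accept g x y = T + (g / 4) * ((norm (gradU x))\<^sup>2 - (norm (gradU y))\<^sup>2)"
  proof -
    have "y - (x - g *\<^sub>R gradU x) = h + g *\<^sub>R gradU x" "x - (y - g *\<^sub>R gradU y) = g *\<^sub>R gradU y - h"
      by (simp_all add: h_def)
    then have "(norm (y - (x - g *\<^sub>R gradU x)))\<^sup>2 - (norm (x - (y - g *\<^sub>R gradU y)))\<^sup>2
      = 2 * g * (h \<bullet> (gradU x + gradU y)) + g\<^sup>2 * ((norm (gradU x))\<^sup>2 - (norm (gradU y))\<^sup>2)"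
      by (simp only: power2_norm_eq_inner)
        (simp add: inner_simps inner_commute power2_eq_square algebra_simps)
    then show ?thesis
      using g_pos by (simp add: log_accept_def T_def field_simps power2_eq_square)
  qed
  have inner_le: "\<bar>h \<bullet> (gradU y - gradU x)\<bar> \<le> L * (norm h)\<^sup>2"
  proof -
    have "\<bar>h \<bullet> (gradU y - gradU x)\<bar> \<le> norm h * norm (gradU y - gradU x)"
      by (rule Cauchy_Schwarz_ineq2)
    also have "\<dots> \<le> norm h * (L * norm h)"
      using grad_diff by (intro mult_left_mono) auto
    finally show ?thesis by (simp add: power2_eq_square ac_simps)
  qed
  \<comment> \<open>The gradient inequalities at the two endpoints bound \<open>T\<close> from above
    and from below by the same quantity up to sign.\<close>
  have "U x + h \<bullet> gradU x \<le> U y"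
  proof -
    have "0 \<le> (m / 2) * (norm (x - y))\<^sup>2" using m_pos by simp
    with strong_convexity[of x y] show ?thesis by (simp add: h_def inner_commute)
  qed
  moreover have "U y - h \<bullet> gradU y \<le> U x"
  proof -
    have "0 \<le> (m / 2) * (norm (y - x))\<^sup>2" using m_pos by simp
    moreover have "gradU y \<bullet> (x - y) = - (h \<bullet> gradU y)"
      by (simp add: h_def inner_simps inner_commute)
    ultimately show ?thesis using strong_convexity[of y x] by linarith
  qed
  ultimately have "T \<le> h \<bullet> (gradU y - gradU x) / 2" "- T \<le> h \<bullet> (gradU y - gradU x) / 2"
    unfolding T_def inner_diff_right inner_add_right by (simp_all add: field_simps)
  then have "\<bar>T\<bar> \<le> \<bar>h \<bullet> (gradU y - gradU x)\<bar> / 2"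
    by simp
  then have T: "\<bar>T\<bar> \<le> (L / 2) * (g * A\<^sup>2)"
    using inner_le mult_left_mono[OF h_sq L_nonneg] by linarith
  have "(g / 4) * \<bar>(norm (gradU x))\<^sup>2 - (norm (gradU y))\<^sup>2\<bar> \<le> (3 * L / 4) * (g * A\<^sup>2)"
  proof -
    \<comment> \<open>Factoring the difference of squares leaves one factor of order
      \<open>norm h\<close>; the other is large only through \<open>gradU x\<close>, which the
      factor \<open>g\<close> turns into a drift of size at most \<open>sqrt g * A\<close>.\<close>
    have "(norm (gradU x))\<^sup>2 - (norm (gradU y))\<^sup>2 = (gradU x - gradU y) \<bullet> (gradU x + gradU y)"
      by (simp add: power2_norm_eq_inner inner_simps inner_commute)
    then have "\<bar>(norm (gradU x))\<^sup>2 - (norm (gradU y))\<^sup>2\<bar> \<le> norm (gradU x - gradU y) * norm (gradU x + gradU y)"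
      by (simp add: Cauchy_Schwarz_ineq2)
    also have "\<dots> \<le> (L * norm h) * (2 * norm (gradU x) + L * norm h)"
    proof (intro mult_mono)
      have "norm (gradU x + gradU y) \<le> norm (2 *\<^sub>R gradU x) + norm (gradU y - gradU x)"
        using norm_triangle_ineq[of "2 *\<^sub>R gradU x" "gradU y - gradU x"] by (simp add: scaleR_2)
      then show "norm (gradU x + gradU y) \<le> 2 * norm (gradU x) + L * norm h"
        using grad_diff by simp
    qed (use grad_diff L_nonneg in \<open>auto simp: norm_minus_commute\<close>)
    finally have "(g / 4) * \<bar>(norm (gradU x))\<^sup>2 - (norm (gradU y))\<^sup>2\<bar>
      \<le> (g / 4) * ((L * norm h) * (2 * norm (gradU x) + L * norm h))"
      using g_pos by (intro mult_left_mono) auto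
    also have "\<dots> = (L / 4) * (2 * (norm h * (g * norm (gradU x))) + (g * L) * (norm h)\<^sup>2)"
      by (simp add: power2_eq_square algebra_simps)
    also have "\<dots> \<le> (L / 4) * (2 * ((sqrt g * A) * (sqrt g * A)) + 1 * (g * A\<^sup>2))"
    proof -
      have "g * L \<le> 1"
        using g_le m_pos L_nonneg g_pos by (simp add: field_simps) (smt (verit) mult_pos_pos)
      then have "(g * L) * (norm h)\<^sup>2 \<le> 1 * (g * A\<^sup>2)"
        using h_sq by (intro mult_mono) auto
      moreover have "norm h * (g * norm (gradU x)) \<le> (sqrt g * A) * (sqrt g * A)"
        using drift_le_amplitude[of x w] g_pos A by (intro mult_mono[OF h_le]) (auto simp: A_def)
      ultimately show ?thesis
        using L_nonneg by (intro mult_left_mono add_mono) auto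
    qed
    also have "(sqrt g * A) * (sqrt g * A) = g * A\<^sup>2"
      using g_pos by (simp add: power2_eq_square)
    finally show ?thesis by (simp add: algebra_simps)
  qed
  then have "\<bar>log_accept g x y\<bar> \<le> (L / 2) * (g * A\<^sup>2) + (3 * L / 4) * (g * A\<^sup>2)"
    unfolding eq using T g_pos
    by (intro order_trans[OF abs_triangle_ineq add_mono]) (auto simp: abs_mult)
  \<comment> \<open>The two coefficients add up to 5/4, rounded up to 2.\<close>
  also have "\<dots> \<le> 2 * L * g * A\<^sup>2"
  proof -
    have "0 \<le> L * (g * A\<^sup>2)" using L_nonneg g_pos by simp
    then show ?thesis by (simp add: mult.assoc)
  qed
  finally show ?thesis by (simp add: y_def A_def)
qed

text \<open>On acceptance the common increment cancels and the distance is \<open>norm D\<close>; on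
  rejection it is at most the sum of \<open>norm D\<close> and the length of the proposed step.
  Since the rejection probability has order \<open>g\<close>, only the cross term needs
  care.\<close>

lemma accept_reject_cost:
  fixes v x w :: "real ^ 'n"
  defines "D \<equiv> (v - g *\<^sub>R gradU v) - (x - g *\<^sub>R gradU x)"
  shows "accept g x (euler_step g x w) * (dist (euler_step g v w) (euler_step g x w))\<^sup>2
      + (1 - accept g x (euler_step g x w)) * (dist (euler_step g v w) x)\<^sup>2
    \<le> (1 + m * g / 2) * (norm D)\<^sup>2 + g\<^sup>2 * local_error x w"
proof -
  define h where "h = euler_step g x w - x"
  define A where "A = amplitude x w"
  define \<rho> where "\<rho> = 1 - accept g x (euler_step g x w)"
  have A: "0 \<le> A" by (simp add: A_def amplitude_nonneg)
  have \<rho>: "0 \<le> \<rho>" "\<rho> \<le> 2 * L * g * A\<^sup>2"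
    using accept_bounds[of g x "euler_step g x w"] reject_le[of g x "euler_step g x w"]
      log_accept_le[of x w] by (auto simp: \<rho>_def A_def)
  have h_sq: "(norm h)\<^sup>2 \<le> g * A\<^sup>2"
    using power_mono[OF norm_euler_step_diff_le[of x w], of 2] g_pos
    by (simp add: power_mult_distrib h_def A_def)
  have d1: "dist (euler_step g v w) (euler_step g x w) = norm D"
    by (simp add: dist_norm euler_step_def D_def)
  have "euler_step g v w - x = D + h"
    by (simp add: euler_step_def D_def h_def)
  then have "(dist (euler_step g v w) x)\<^sup>2 \<le> (norm D + norm h)\<^sup>2"
    unfolding dist_norm by (metis norm_triangle_ineq norm_ge_zero power_mono)
  then have "accept g x (euler_step g x w) * (norm D)\<^sup>2 + \<rho> * (dist (euler_step g v w) x)\<^sup>2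
    \<le> (1 - \<rho>) * (norm D)\<^sup>2 + \<rho> * (norm D + norm h)\<^sup>2"
    using \<rho> by (intro add_mono mult_left_mono) (auto simp: \<rho>_def)
  also have "\<dots> = (norm D)\<^sup>2 + 2 * (norm D * (\<rho> * norm h)) + \<rho> * (norm h)\<^sup>2"
    by (simp add: power2_eq_square algebra_simps)
  \<comment> \<open>Young's inequality with weight \<open>m * g / 2\<close>: small enough to use up
    only half of a contraction by \<open>1 - m * g\<close>, while
    \<open>(\<rho> * norm h)\<^sup>2\<close> has order \<open>g ^ 3\<close>, so that dividing by
    \<open>m * g\<close> still leaves order \<open>g\<^sup>2\<close>.\<close>
  also have "\<dots> \<le> (norm D)\<^sup>2 + ((m * g / 2) * (norm D)\<^sup>2 + (2 / (m * g)) * (\<rho> * norm h)\<^sup>2) + \<rho> * (norm h)\<^sup>2"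
  proof -
    have "0 \<le> ((m * g / 2) * norm D - \<rho> * norm h)\<^sup>2 * (2 / (m * g))"
      using m_pos g_pos by simp
    also have "\<dots> = (m * g / 2) * (norm D)\<^sup>2 + (2 / (m * g)) * (\<rho> * norm h)\<^sup>2 - 2 * (norm D * (\<rho> * norm h))"
      using m_pos g_pos by (simp add: field_simps power2_eq_square)
    finally show ?thesis by simp
  qed
  also have "\<dots> \<le> (norm D)\<^sup>2 + ((m * g / 2) * (norm D)\<^sup>2 + (2 / (m * g)) * ((2 * L * g * A\<^sup>2)\<^sup>2 * (g * A\<^sup>2)))
      + (2 * L * g * A\<^sup>2) * (g * A\<^sup>2)"
    using \<rho> h_sq m_pos g_pos L_nonneg unfolding power_mult_distrib[of \<rho>]
    by (intro add_mono mult_mono order_refl power_mono) auto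
  also have "\<dots> = (1 + m * g / 2) * (norm D)\<^sup>2 + g\<^sup>2 * local_error x w"
    using m_pos g_pos
    by (simp add: local_error_def A_def[symmetric] field_simps eval_nat_numeral)
  finally show ?thesis by (simp add: d1 \<rho>_def)
qed

end

section \<open>Growth of the local error\<close>

lemma local_error_nonneg: "0 \<le> local_error x w"
  using L_nonneg m_pos amplitude_nonneg[of x w] by (simp add: local_error_def)

lemma borel_measurable_local_error [measurable]:
  "(\<lambda>(x, w). local_error x w) \<in> borel_measurable (borel \<Otimes>\<^sub>M borel)"
  unfolding local_error_def amplitude_def by measurable

lemma local_error_le:
  obtains C where "0 \<le> C" "\<And>x w. local_error x w \<le> C * (1 + norm x ^ 6 + norm w ^ 6)"
proof
  define K where "K = 64 * (sqrt (1 / (m + L)) ^ 6 * (64 * (norm (gradU 0) ^ 6 + L ^ 6)) + sqrt 2 ^ 6)"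
  have K: "0 \<le> K" using L_nonneg m_pos by (simp add: K_def)
  show "0 \<le> (8 * L\<^sup>2 / m + 2 * L) * (K + 1)"
    using K L_nonneg m_pos by simp
  fix x w :: "real ^ 'n"
  have grad: "norm (gradU x) ^ 6 \<le> 64 * (norm (gradU 0) ^ 6 + L ^ 6) * (1 + norm x ^ 6)"
  proof -
    have "norm (gradU x) \<le> norm (gradU 0) + L * norm x"
      using Lipschitz[of x 0] norm_triangle_ineq2[of "gradU x" "gradU 0"] by simp
    then have "norm (gradU x) ^ 6 \<le> (norm (gradU 0) + L * norm x) ^ 6"
      by (intro power_mono) auto
    also have "\<dots> \<le> 64 * (norm (gradU 0) ^ 6 + L ^ 6 * norm x ^ 6)"
      using power6_add_le[of "norm (gradU 0)" "L * norm x"] L_nonneg by (simp add: power_mult_distrib)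
    also have "\<dots> \<le> 64 * (norm (gradU 0) ^ 6 + L ^ 6) * (1 + norm x ^ 6)"
      by (simp add: algebra_simps)
    finally show ?thesis .
  qed
  have "amplitude x w ^ 6 \<le> 64 * (sqrt (1 / (m + L)) ^ 6 * norm (gradU x) ^ 6 + sqrt 2 ^ 6 * norm w ^ 6)"
    unfolding amplitude_def
    using power6_add_le[of "sqrt (1 / (m + L)) * norm (gradU x)" "sqrt 2 * norm w"] L_nonneg m_pos
    by (simp only: power_mult_distrib) simp
  also have "\<dots> \<le> 64 * (sqrt (1 / (m + L)) ^ 6 * (64 * (norm (gradU 0) ^ 6 + L ^ 6) * (1 + norm x ^ 6 + norm w ^ 6))
      + sqrt 2 ^ 6 * (1 + norm x ^ 6 + norm w ^ 6))"
  proof (intro mult_left_mono add_mono)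
    show "norm (gradU x) ^ 6 \<le> 64 * (norm (gradU 0) ^ 6 + L ^ 6) * (1 + norm x ^ 6 + norm w ^ 6)"
      by (rule order_trans[OF grad mult_left_mono]) (use L_nonneg in auto)
  qed (use L_nonneg m_pos in auto)
  also have "\<dots> = K * (1 + norm x ^ 6 + norm w ^ 6)"
    unfolding K_def by (simp only: algebra_simps)
  finally have A6: "amplitude x w ^ 6 \<le> K * (1 + norm x ^ 6 + norm w ^ 6)" .
  have A4: "amplitude x w ^ 4 \<le> 1 + amplitude x w ^ 6"
  proof (cases "amplitude x w \<le> 1")
    case True
    then have "amplitude x w ^ 4 \<le> 1" using amplitude_nonneg by (simp add: power_le_one)
    then show ?thesis using amplitude_nonneg[of x w] by (simp add: add_increasing2)
  next
    case False
    then have "amplitude x w ^ 4 \<le> amplitude x w ^ 6" by (intro power_increasing) auto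
    then show ?thesis by simp
  qed
  have "local_error x w \<le> (8 * L\<^sup>2 / m) * (1 + amplitude x w ^ 6) + 2 * L * (1 + amplitude x w ^ 6)"
    unfolding local_error_def using A4 L_nonneg m_pos by (intro add_mono mult_left_mono) auto
  also have "\<dots> = (8 * L\<^sup>2 / m + 2 * L) * (1 + amplitude x w ^ 6)"
    by (simp add: distrib_right)
  also have "\<dots> \<le> (8 * L\<^sup>2 / m + 2 * L) * ((K + 1) * (1 + norm x ^ 6 + norm w ^ 6))"
  proof (rule mult_left_mono)
    show "1 + amplitude x w ^ 6 \<le> (K + 1) * (1 + norm x ^ 6 + norm w ^ 6)"
    proof -
      have "0 \<le> norm x ^ 6 + norm w ^ 6" by simp
      with A6 show ?thesis unfolding distrib_right[of K] mult_1 by linarith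
    qed
  qed (use L_nonneg m_pos in auto)
  finally show "local_error x w \<le> (8 * L\<^sup>2 / m + 2 * L) * (K + 1) * (1 + norm x ^ 6 + norm w ^ 6)"
    by (simp add: mult.assoc)
qed

lemma exp_minus_U_le:
  "exp (- U x) \<le> exp ((norm (gradU 0))\<^sup>2 / m - U 0) * exp (- (norm x)\<^sup>2 / (2 * (2 / m)))"
proof -
  have "\<bar>gradU 0 \<bullet> x\<bar> \<le> norm (gradU 0) * norm x" by (rule Cauchy_Schwarz_ineq2)
  moreover have "norm (gradU 0) * norm x \<le> (norm (gradU 0))\<^sup>2 / m + (m / 4) * (norm x)\<^sup>2"
  proof -
    have "0 \<le> (norm (gradU 0) - (m / 2) * norm x)\<^sup>2 / m" using m_pos by simp
    also have "\<dots> = (norm (gradU 0))\<^sup>2 / m + (m / 4) * (norm x)\<^sup>2 - norm (gradU 0) * norm x"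
      using m_pos by (simp add: field_simps power2_eq_square)
    finally show ?thesis by simp
  qed
  ultimately have "- U x \<le> (norm (gradU 0))\<^sup>2 / m - U 0 + - (norm x)\<^sup>2 / (2 * (2 / m))"
    using strong_convexity[of 0 x] by (simp add: mult.commute)
  then show ?thesis by (simp only: exp_add[symmetric] exp_le_cancel_iff)
qed

definition partition :: real where
  "partition = enn2real (\<integral>\<^sup>+ y. ennreal (exp (- U y)) \<partial>lborel)"

definition gibbs_density :: "real ^ 'n \<Rightarrow> real" where
  "gibbs_density x = exp (- U x) / partition"

lemma partition: "(\<integral>\<^sup>+ y. ennreal (exp (- U y)) \<partial>lborel) = ennreal partition" "0 < partition"
proof -
  have "(\<integral>\<^sup>+ y. ennreal (exp (- U y)) \<partial>lborel)
    \<le> (\<integral>\<^sup>+ y. ennreal (exp ((norm (gradU 0))\<^sup>2 / m - U 0)) * ennreal (exp (- (norm y)\<^sup>2 / (2 * (2 / m))))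
        \<partial>(lborel :: (real ^ 'n) measure))"
    by (intro nn_integral_mono, subst ennreal_mult[symmetric]; (rule ennreal_leI exp_minus_U_le exp_ge_zero)+)
  also have "\<dots> < \<infinity>"
    using nn_integral_exp_norm_sq[of "2 / m", where 'a = "real ^ 'n"] m_pos
    by (subst nn_integral_cmult) (auto simp: ennreal_mult_less_top)
  finally show *: "(\<integral>\<^sup>+ y. ennreal (exp (- U y)) \<partial>lborel) = ennreal partition"
    by (simp add: partition_def)
  have "(\<integral>\<^sup>+ y. ennreal (exp (- U y)) \<partial>lborel) \<noteq> 0"
    by (subst nn_integral_0_iff_AE) (auto simp: ae_filter_eq_bot_iff eventually_False)
  with * show "0 < partition" by (simp add: zero_less_iff_neq_zero[symmetric])
qed

lemma gibbs_density_pos: "0 < gibbs_density x"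
  using partition by (simp add: gibbs_density_def)

lemma borel_measurable_gibbs_density [measurable]: "gibbs_density \<in> borel_measurable borel"
  unfolding gibbs_density_def by measurable

lemma gibbs_measure_eq: "gibbs_measure U = density lborel (\<lambda>x. ennreal (gibbs_density x))"
  using partition by (simp add: gibbs_measure_def gibbs_density_def divide_ennreal)

lemma sets_gibbs_measure [simp, measurable_cong]: "sets (gibbs_measure U) = sets borel"
  by (simp add: gibbs_measure_def)

lemma space_gibbs_measure [simp]: "space (gibbs_measure U) = UNIV"
  by (simp add: gibbs_measure_def)

lemma prob_space_gibbs_measure: "prob_space (gibbs_measure U)"
proof
  have "(\<integral>\<^sup>+ x. ennreal (gibbs_density x) \<partial>lborel)
    = (\<integral>\<^sup>+ x. ennreal (1 / partition) * ennreal (exp (- U x)) \<partial>lborel)"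
    using partition by (simp add: gibbs_density_def ennreal_mult[symmetric])
  also have "\<dots> = 1"
    using partition by (subst nn_integral_cmult) (auto simp: ennreal_mult[symmetric])
  finally show "emeasure (gibbs_measure U) (space (gibbs_measure U)) = 1"
    by (simp add: gibbs_measure_eq emeasure_density)
qed

lemma gibbs_norm_power6_finite: "(\<integral>\<^sup>+ x. ennreal (norm x ^ 6) \<partial>gibbs_measure U) < \<infinity>"
proof -
  define c where "c = exp ((norm (gradU 0))\<^sup>2 / m - U 0) / partition"
  have "(\<integral>\<^sup>+ x. ennreal (norm x ^ 6) \<partial>gibbs_measure U)
    = (\<integral>\<^sup>+ x. ennreal (gibbs_density x * norm x ^ 6) \<partial>lborel)"
    by (simp add: gibbs_measure_eq nn_integral_density ennreal_mult gibbs_density_pos less_imp_le)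
  also have "\<dots> \<le> (\<integral>\<^sup>+ x. ennreal c * ennreal (norm x ^ 6 * exp (- (norm x)\<^sup>2 / (2 * (2 / m))))
      \<partial>(lborel :: (real ^ 'n) measure))"
  proof (intro nn_integral_mono)
    fix x :: "real ^ 'n"
    have "gibbs_density x \<le> c * exp (- (norm x)\<^sup>2 / (2 * (2 / m)))"
      using divide_right_mono[OF exp_minus_U_le[of x], of partition] partition(2)
      by (simp add: gibbs_density_def c_def)
    then have "gibbs_density x * norm x ^ 6 \<le> c * (norm x ^ 6 * exp (- (norm x)\<^sup>2 / (2 * (2 / m))))"
      using mult_right_mono[of "gibbs_density x" "c * exp (- (norm x)\<^sup>2 / (2 * (2 / m)))" "norm x ^ 6"]
      by (simp add: mult_ac)
    moreover have "0 \<le> c" using partition(2) by (simp add: c_def)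
    ultimately show "ennreal (gibbs_density x * norm x ^ 6)
      \<le> ennreal c * ennreal (norm x ^ 6 * exp (- (norm x)\<^sup>2 / (2 * (2 / m))))"
      by (subst ennreal_mult[symmetric]) (auto intro: ennreal_leI)
  qed
  also have "\<dots> < \<infinity>"
    using nn_integral_norm_power6_exp_finite[of "2 / m", where 'a = "real ^ 'n"] m_pos
    by (subst nn_integral_cmult) (auto simp: ennreal_mult_less_top)
  finally show ?thesis .
qed

lemma local_error_finite:
  "(\<integral>\<^sup>+ x. \<integral>\<^sup>+ w. ennreal (local_error x w) \<partial>std_gaussian \<partial>gibbs_measure U) < \<infinity>"
proof -
  interpret N: prob_space "std_gaussian :: (real ^ 'n) measure" by (rule prob_space_std_gaussian)
  interpret G: prob_space "gibbs_measure U" by (rule prob_space_gibbs_measure)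
  obtain C where C: "0 \<le> C" "\<And>x w. local_error x w \<le> C * (1 + norm x ^ 6 + norm w ^ 6)"
    using local_error_le by blast
  have "(\<integral>\<^sup>+ x. \<integral>\<^sup>+ w. ennreal (local_error x w) \<partial>std_gaussian \<partial>gibbs_measure U)
    \<le> (\<integral>\<^sup>+ x. \<integral>\<^sup>+ w. ennreal C * (1 + ennreal (norm x ^ 6) + ennreal (norm w ^ 6))
        \<partial>(std_gaussian :: (real ^ 'n) measure) \<partial>gibbs_measure U)"
  proof (intro nn_integral_mono)
    fix x w :: "real ^ 'n"
    have "ennreal C * (1 + ennreal (norm x ^ 6) + ennreal (norm w ^ 6)) = ennreal (C * (1 + norm x ^ 6 + norm w ^ 6))"
      using C(1) by (simp add: ennreal_mult flip: ennreal_1)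
    then show "ennreal (local_error x w) \<le> ennreal C * (1 + ennreal (norm x ^ 6) + ennreal (norm w ^ 6))"
      using C(2)[of x w] by (simp add: ennreal_leI)
  qed
  also have "\<dots> = ennreal C * (1 + (\<integral>\<^sup>+ x. ennreal (norm x ^ 6) \<partial>gibbs_measure U)
      + (\<integral>\<^sup>+ w. ennreal (norm w ^ 6) \<partial>(std_gaussian :: (real ^ 'n) measure)))"
    by (simp add: nn_integral_cmult nn_integral_add N.emeasure_space_1[simplified] G.emeasure_space_1[simplified])
  also have "\<dots> < \<infinity>"
    using gibbs_norm_power6_finite std_gaussian_norm_power6_finite[where 'n = 'n]
    by (simp add: ennreal_mult_less_top)
  finally show ?thesis .
qed

lemma nn_integral_gibbs_metropolis:
  assumes g: "0 < g" and f [measurable]: "f \<in> borel_measurable borel"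
  shows "(\<integral>\<^sup>+ x. \<integral>\<^sup>+ w. ennreal (accept g x (euler_step g x w)) * f (euler_step g x w)
      + ennreal (1 - accept g x (euler_step g x w)) * f x \<partial>std_gaussian \<partial>gibbs_measure U)
    = (\<integral>\<^sup>+ x. f x \<partial>gibbs_measure U)"
proof -
  define r where "r x y = gibbs_density x * gauss_density (2 * g) (y - (x - g *\<^sub>R gradU x))" for x y
  have r_pos: "0 < r x y" for x y
    using g by (simp add: r_def gibbs_density_pos gauss_density_pos)
  have [measurable]: "(\<lambda>(x, y). r x y) \<in> borel_measurable (borel \<Otimes>\<^sub>M borel)"
    unfolding r_def by measurable
  then have r_meas: "(\<lambda>(x, y). r x y) \<in> borel_measurable (lborel \<Otimes>\<^sub>M lborel)"
    by (simp cong: measurable_cong_sets sets_pair_measure_cong)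
  have acc: "accept g x y = min 1 (r y x / r x y)" for x y
  proof -
    have "r y x / r x y = (gibbs_density y / gibbs_density x)
      * (gauss_density (2 * g) (x - (y - g *\<^sub>R gradU y)) / gauss_density (2 * g) (y - (x - g *\<^sub>R gradU x)))"
      by (simp add: r_def)
    also have "gibbs_density y / gibbs_density x = exp (U x - U y)"
      using partition(2) by (simp add: gibbs_density_def exp_diff exp_minus field_simps)
    also have "gauss_density (2 * g) (x - (y - g *\<^sub>R gradU y)) / gauss_density (2 * g) (y - (x - g *\<^sub>R gradU x))
      = exp (- (norm (x - (y - g *\<^sub>R gradU y)))\<^sup>2 / (2 * (2 * g)) - - (norm (y - (x - g *\<^sub>R gradU x)))\<^sup>2 / (2 * (2 * g)))"
      using g unfolding gauss_density_def exp_diff by simp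
    also have "exp (U x - U y) * \<dots> = exp (log_accept g x y)"
      unfolding exp_add[symmetric] log_accept_def by (simp add: diff_divide_distrib)
    finally show ?thesis by (simp add: accept_def)
  qed
  have inner: "ennreal (gibbs_density x) * (\<integral>\<^sup>+ w. H (euler_step g x w) \<partial>std_gaussian)
      = (\<integral>\<^sup>+ y. ennreal (r x y) * H y \<partial>lborel)"
    if [measurable]: "H \<in> borel_measurable borel" for x and H :: "real ^ 'n \<Rightarrow> ennreal"
    unfolding nn_integral_euler_step[OF g that] r_def
    by (subst nn_integral_cmult[symmetric])
      (auto simp: ennreal_mult gibbs_density_pos gauss_density_pos g less_imp_le mult.assoc)
  have "(\<integral>\<^sup>+ x. \<integral>\<^sup>+ w. ennreal (accept g x (euler_step g x w)) * f (euler_step g x w)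
      + ennreal (1 - accept g x (euler_step g x w)) * f x \<partial>std_gaussian \<partial>gibbs_measure U)
    = (\<integral>\<^sup>+ x. \<integral>\<^sup>+ y. ennreal (r x y) * (ennreal (accept g x y) * f y
      + ennreal (1 - accept g x y) * f x) \<partial>lborel \<partial>lborel)"
  proof -
    interpret N: prob_space "std_gaussian :: (real ^ 'n) measure" by (rule prob_space_std_gaussian)
    have "(\<integral>\<^sup>+ x. \<integral>\<^sup>+ w. ennreal (accept g x (euler_step g x w)) * f (euler_step g x w)
        + ennreal (1 - accept g x (euler_step g x w)) * f x \<partial>std_gaussian \<partial>gibbs_measure U)
      = (\<integral>\<^sup>+ x. ennreal (gibbs_density x) * (\<integral>\<^sup>+ w. ennreal (accept g x (euler_step g x w)) * f (euler_step g x w)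
        + ennreal (1 - accept g x (euler_step g x w)) * f x \<partial>std_gaussian) \<partial>lborel)"
      unfolding gibbs_measure_eq by (intro nn_integral_density) measurable
    also have "\<dots> = (\<integral>\<^sup>+ x. \<integral>\<^sup>+ y. ennreal (r x y) * (ennreal (accept g x y) * f y
      + ennreal (1 - accept g x y) * f x) \<partial>lborel \<partial>lborel)"
      by (intro nn_integral_cong inner) measurable
    finally show ?thesis .
  qed
  also have "\<dots> = (\<integral>\<^sup>+ x. \<integral>\<^sup>+ y. ennreal (r x y) * f x \<partial>lborel \<partial>lborel)"
    unfolding acc by (intro nn_integral_metropolis r_meas r_pos sigma_finite_lborel) measurable
  also have "\<dots> = (\<integral>\<^sup>+ x. ennreal (gibbs_density x) * f x \<partial>lborel)"
    by (intro nn_integral_cong, subst inner[symmetric])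
      (auto simp: prob_space.emeasure_space_1[OF prob_space_std_gaussian, simplified])
  also have "\<dots> = (\<integral>\<^sup>+ x. f x \<partial>gibbs_measure U)"
    unfolding gibbs_measure_eq by (intro nn_integral_density[symmetric]) measurable
  finally show ?thesis .
qed

text \<open>The same Gaussian increment \<open>w\<close> drives both components; the uniform variable \<open>u\<close> decides
  whether the second one accepts its proposal.\<close>

definition coupled_step :: "real \<Rightarrow> ((real ^ 'n) \<times> (real ^ 'n)) \<times> ((real ^ 'n) \<times> real) \<Rightarrow> (real ^ 'n) \<times> (real ^ 'n)" where
  "coupled_step g = (\<lambda>((v, x), (w, u)). (euler_step g v w,
     if u \<le> accept g x (euler_step g x w) then euler_step g x w else x))"

definition noise :: "((real ^ 'n) \<times> real) measure" where
  "noise = std_gaussian \<Otimes>\<^sub>M uniform_measure lborel {0..1}"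

lemma sets_noise [measurable_cong]: "sets noise = sets (borel \<Otimes>\<^sub>M borel)"
  unfolding noise_def by (intro sets_pair_measure_cong) auto

lemma prob_space_noise: "prob_space noise"
  unfolding noise_def
  by (intro prob_space_pair prob_space_std_gaussian prob_space_uniform_measure) auto

lemma measurable_coupled_step:
  "coupled_step g \<in> (borel \<Otimes>\<^sub>M borel) \<Otimes>\<^sub>M noise \<rightarrow>\<^sub>M borel \<Otimes>\<^sub>M borel"
  unfolding coupled_step_def case_prod_beta by measurable

lemma nn_integral_coupled_step:
  assumes \<zeta>: "\<zeta> \<in> space (prob_algebra (borel \<Otimes>\<^sub>M borel))"
    and f [measurable]: "f \<in> borel_measurable (borel \<Otimes>\<^sub>M borel)"
  shows "(\<integral>\<^sup>+ z. f z \<partial>distr (\<zeta> \<Otimes>\<^sub>M noise) (borel \<Otimes>\<^sub>M borel) (coupled_step g))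
    = (\<integral>\<^sup>+ (v, x). \<integral>\<^sup>+ w. ennreal (accept g x (euler_step g x w)) * f (euler_step g v w, euler_step g x w)
        + ennreal (1 - accept g x (euler_step g x w)) * f (euler_step g v w, x) \<partial>std_gaussian \<partial>\<zeta>)"
proof -
  have [measurable_cong]: "sets \<zeta> = sets (borel \<Otimes>\<^sub>M borel)" and prob: "prob_space \<zeta>"
    using \<zeta> by (auto simp: space_prob_algebra)
  note measurable_coupled_step [measurable]
  interpret Z: prob_space noise by (rule prob_space_noise)
  interpret V: prob_space "uniform_measure lborel {0..1::real}"
    by (rule prob_space_uniform_measure) auto
  have "(\<integral>\<^sup>+ z. f z \<partial>distr (\<zeta> \<Otimes>\<^sub>M noise) (borel \<Otimes>\<^sub>M borel) (coupled_step g))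
    = (\<integral>\<^sup>+ q. f (coupled_step g q) \<partial>(\<zeta> \<Otimes>\<^sub>M noise))"
    by (rule nn_integral_distr) measurable
  also have "\<dots> = (\<integral>\<^sup>+ p. \<integral>\<^sup>+ e. f (coupled_step g (p, e)) \<partial>noise \<partial>\<zeta>)"
    by (rule Z.nn_integral_fst[symmetric]) measurable
  also have "\<dots> = (\<integral>\<^sup>+ p. \<integral>\<^sup>+ w. \<integral>\<^sup>+ u. f (coupled_step g (p, (w, u))) \<partial>uniform_measure lborel {0..1}
      \<partial>std_gaussian \<partial>\<zeta>)"
  proof (rule nn_integral_cong)
    fix p :: "(real ^ 'n) \<times> (real ^ 'n)"
    have "(\<lambda>e. f (coupled_step g (p, e))) \<in> borel_measurable noise"
      by (rule measurable_compose[OF measurable_Pair1'[of p "borel \<Otimes>\<^sub>M borel"]])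
        (auto simp: space_pair_measure)
    then show "(\<integral>\<^sup>+ e. f (coupled_step g (p, e)) \<partial>noise) = (\<integral>\<^sup>+ w. \<integral>\<^sup>+ u. f (coupled_step g (p, (w, u)))
        \<partial>uniform_measure lborel {0..1} \<partial>std_gaussian)"
      unfolding noise_def by (rule V.nn_integral_fst[symmetric])
  qed
  also have "\<dots> = (\<integral>\<^sup>+ (v, x). \<integral>\<^sup>+ w. ennreal (accept g x (euler_step g x w)) * f (euler_step g v w, euler_step g x w)
        + ennreal (1 - accept g x (euler_step g x w)) * f (euler_step g v w, x) \<partial>std_gaussian \<partial>\<zeta>)"
    by (intro nn_integral_cong)
      (simp add: coupled_step_def split_beta if_distrib[of "\<lambda>y. f (_, y)"] accept_bounds
        nn_integral_uniform_threshold cong: if_cong)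
  finally show ?thesis .
qed

lemma coupled_step_in_couplings:
  assumes g: "0 < g"
    and \<zeta>: "\<zeta> \<in> couplings \<mu> (gibbs_measure U)"
  shows "distr (\<zeta> \<Otimes>\<^sub>M noise) (borel \<Otimes>\<^sub>M borel) (coupled_step g)
    \<in> couplings (\<mu> \<bind> euler_kernel gradU g) (gibbs_measure U)"
proof -
  define \<zeta>' where "\<zeta>' = distr (\<zeta> \<Otimes>\<^sub>M noise) (borel \<Otimes>\<^sub>M borel) (coupled_step g)"
  have \<zeta>p: "\<zeta> \<in> space (prob_algebra (borel \<Otimes>\<^sub>M borel))"
    and fst: "distr \<zeta> borel fst = \<mu>" and snd: "distr \<zeta> borel snd = gibbs_measure U"
    using \<zeta> by (auto simp: couplings_def)
  have [measurable_cong]: "sets \<zeta> = sets (borel \<Otimes>\<^sub>M borel)" and prob: "prob_space \<zeta>"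
    using \<zeta>p by (auto simp: space_prob_algebra)
  have \<mu> [measurable_cong]: "sets \<mu> = sets borel" and space_\<mu>: "space \<mu> = UNIV"
    by (auto simp flip: fst)
  have [measurable_cong]: "sets \<zeta>' = sets (borel \<Otimes>\<^sub>M borel)" by (simp add: \<zeta>'_def)
  interpret N: prob_space "std_gaussian :: (real ^ 'n) measure" by (rule prob_space_std_gaussian)
  note measurable_coupled_step [measurable]
  have step_meas: "coupled_step g \<in> \<zeta> \<Otimes>\<^sub>M noise \<rightarrow>\<^sub>M borel \<Otimes>\<^sub>M borel" by measurable
  have kernel: "euler_kernel gradU g \<in> \<mu> \<rightarrow>\<^sub>M subprob_algebra borel"
    using measurable_prob_algebraD[OF measurable_euler_kernel[OF g]] by measurable
  have merge: "ennreal (accept g x y) * a + ennreal (1 - accept g x y) * a = a" for x y and a :: ennreal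
    by (simp add: distrib_right[symmetric] accept_bounds flip: ennreal_plus)
  have fst': "distr \<zeta>' borel fst = \<mu> \<bind> euler_kernel gradU g"
  proof (rule measure_eqI)
    show "sets (distr \<zeta>' borel fst) = sets (\<mu> \<bind> euler_kernel gradU g)"
      by (subst sets_bind[where N = borel]) (auto simp: euler_kernel_def space_\<mu>)
    fix A assume "A \<in> sets (distr \<zeta>' borel fst)"
    then have A [measurable]: "A \<in> sets borel" by simp
    have "emeasure (distr \<zeta>' borel fst) A = (\<integral>\<^sup>+ z. indicator A z \<partial>distr \<zeta>' borel fst)"
      by simp
    also have "\<dots> = (\<integral>\<^sup>+ z. indicator A (fst z) \<partial>\<zeta>')"
      by (rule nn_integral_distr) measurable
    also have "\<dots> = (\<integral>\<^sup>+ p. \<integral>\<^sup>+ w. indicator A (euler_step g (fst p) w) \<partial>std_gaussian \<partial>\<zeta>)"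
      unfolding \<zeta>'_def by (subst nn_integral_coupled_step[OF \<zeta>p]) (auto simp: merge intro!: nn_integral_cong)
    also have "\<dots> = (\<integral>\<^sup>+ v. \<integral>\<^sup>+ w. indicator A (euler_step g v w) \<partial>std_gaussian \<partial>\<mu>)"
      by (simp add: fst[symmetric] nn_integral_distr)
    also have "\<dots> = (\<integral>\<^sup>+ v. emeasure (euler_kernel gradU g v) A \<partial>\<mu>)"
    proof (intro nn_integral_cong)
      fix v :: "real ^ 'n"
      show "(\<integral>\<^sup>+ w. indicator A (euler_step g v w) \<partial>std_gaussian) = emeasure (euler_kernel gradU g v) A"
        unfolding euler_kernel_eq_distr[OF g]
        using nn_integral_distr[of "euler_step g v" std_gaussian borel "indicator A"] by simp
    qed
    also have "\<dots> = emeasure (\<mu> \<bind> euler_kernel gradU g) A"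
      by (subst emeasure_bind[OF _ kernel A]) (auto simp: space_\<mu>)
    finally show "emeasure (distr \<zeta>' borel fst) A = emeasure (\<mu> \<bind> euler_kernel gradU g) A" .
  qed
  have snd': "distr \<zeta>' borel snd = gibbs_measure U"
  proof (rule measure_eqI)
    fix A assume "A \<in> sets (distr \<zeta>' borel snd)"
    then have A [measurable]: "A \<in> sets borel" by simp
    have "emeasure (distr \<zeta>' borel snd) A = (\<integral>\<^sup>+ z. indicator A z \<partial>distr \<zeta>' borel snd)"
      by simp
    also have "\<dots> = (\<integral>\<^sup>+ z. indicator A (snd z) \<partial>\<zeta>')"
      by (rule nn_integral_distr) measurable
    also have "\<dots> = (\<integral>\<^sup>+ p. \<integral>\<^sup>+ w. ennreal (accept g (snd p) (euler_step g (snd p) w)) * indicator A (euler_step g (snd p) w)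
      + ennreal (1 - accept g (snd p) (euler_step g (snd p) w)) * indicator A (snd p) \<partial>std_gaussian \<partial>\<zeta>)"
      unfolding \<zeta>'_def by (subst nn_integral_coupled_step[OF \<zeta>p]) (auto intro!: nn_integral_cong)
    also have "\<dots> = (\<integral>\<^sup>+ x. \<integral>\<^sup>+ w. ennreal (accept g x (euler_step g x w)) * indicator A (euler_step g x w)
      + ennreal (1 - accept g x (euler_step g x w)) * indicator A x \<partial>std_gaussian \<partial>gibbs_measure U)"
      unfolding snd[symmetric] by (rule nn_integral_distr[symmetric]) measurable
    also have "\<dots> = (\<integral>\<^sup>+ x. indicator A x \<partial>gibbs_measure U)"
      by (rule nn_integral_gibbs_metropolis[OF g]) measurable
    finally show "emeasure (distr \<zeta>' borel snd) A = emeasure (gibbs_measure U) A"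
      by simp
  qed simp
  have "prob_space \<zeta>'"
    unfolding \<zeta>'_def
    by (intro prob_space.prob_space_distr prob_space_pair prob prob_space_noise step_meas)
  then show ?thesis
    using fst' snd' unfolding \<zeta>'_def[symmetric] by (simp add: couplings_def space_prob_algebra \<zeta>'_def)
qed

definition cost :: "((real ^ 'n) \<times> (real ^ 'n)) measure \<Rightarrow> ennreal" where
  "cost \<zeta> = (\<integral>\<^sup>+ z. ennreal ((dist (fst z) (snd z))\<^sup>2) \<partial>\<zeta>)"

definition error_bound :: real where
  "error_bound = enn2real (\<integral>\<^sup>+ x. \<integral>\<^sup>+ w. ennreal (local_error x w) \<partial>std_gaussian \<partial>gibbs_measure U)"

lemma cost_coupled_step_le:
  assumes g: "0 < g" "g \<le> 1 / (m + L)"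
    and \<zeta>: "\<zeta> \<in> couplings \<mu> (gibbs_measure U)"
    and q: "0 \<le> q"
    and contraction: "\<And>v x. (norm ((v - g *\<^sub>R gradU v) - (x - g *\<^sub>R gradU x)))\<^sup>2 \<le> q * (norm (v - x))\<^sup>2"
  shows "cost (distr (\<zeta> \<Otimes>\<^sub>M noise) (borel \<Otimes>\<^sub>M borel) (coupled_step g))
    \<le> ennreal ((1 + m * g / 2) * q) * cost \<zeta> + ennreal (g\<^sup>2 * error_bound)"
proof -
  have \<zeta>p: "\<zeta> \<in> space (prob_algebra (borel \<Otimes>\<^sub>M borel))" and snd: "distr \<zeta> borel snd = gibbs_measure U"
    using \<zeta> by (auto simp: couplings_def)
  have [measurable_cong]: "sets \<zeta> = sets (borel \<Otimes>\<^sub>M borel)"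
    using \<zeta>p by (auto simp: space_prob_algebra)
  interpret N: prob_space "std_gaussian :: (real ^ 'n) measure" by (rule prob_space_std_gaussian)
  have "cost (distr (\<zeta> \<Otimes>\<^sub>M noise) (borel \<Otimes>\<^sub>M borel) (coupled_step g))
    = (\<integral>\<^sup>+ (v, x). \<integral>\<^sup>+ w. ennreal (accept g x (euler_step g x w)) * ennreal ((dist (euler_step g v w) (euler_step g x w))\<^sup>2)
        + ennreal (1 - accept g x (euler_step g x w)) * ennreal ((dist (euler_step g v w) x)\<^sup>2) \<partial>std_gaussian \<partial>\<zeta>)"
    unfolding cost_def by (subst nn_integral_coupled_step[OF \<zeta>p]) auto
  also have "\<dots> \<le> (\<integral>\<^sup>+ (v, x). \<integral>\<^sup>+ w. ennreal ((1 + m * g / 2) * q) * ennreal ((dist v x)\<^sup>2)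
        + ennreal (g\<^sup>2) * ennreal (local_error x w) \<partial>std_gaussian \<partial>\<zeta>)"
  proof (intro nn_integral_mono, clarify, intro nn_integral_mono)
    fix v x w :: "real ^ 'n"
    have "accept g x (euler_step g x w) * (dist (euler_step g v w) (euler_step g x w))\<^sup>2
        + (1 - accept g x (euler_step g x w)) * (dist (euler_step g v w) x)\<^sup>2
      \<le> (1 + m * g / 2) * (norm ((v - g *\<^sub>R gradU v) - (x - g *\<^sub>R gradU x)))\<^sup>2 + g\<^sup>2 * local_error x w"
      by (rule accept_reject_cost[OF g])
    also have "\<dots> \<le> (1 + m * g / 2) * (q * (dist v x)\<^sup>2) + g\<^sup>2 * local_error x w"
      using contraction[of v x] m_pos g by (intro add_mono mult_left_mono) (auto simp: dist_norm)
    finally show "ennreal (accept g x (euler_step g x w)) * ennreal ((dist (euler_step g v w) (euler_step g x w))\<^sup>2)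
        + ennreal (1 - accept g x (euler_step g x w)) * ennreal ((dist (euler_step g v w) x)\<^sup>2)
      \<le> ennreal ((1 + m * g / 2) * q) * ennreal ((dist v x)\<^sup>2) + ennreal (g\<^sup>2) * ennreal (local_error x w)"
      using q m_pos g accept_bounds[of g x "euler_step g x w"] local_error_nonneg[of x w]
      by (simp add: ennreal_mult[symmetric] ennreal_plus[symmetric] mult.assoc ennreal_leI del: ennreal_plus)
  qed
  also have "\<dots> = (\<integral>\<^sup>+ p. ennreal ((1 + m * g / 2) * q) * ennreal ((dist (fst p) (snd p))\<^sup>2)
        + ennreal (g\<^sup>2) * (\<integral>\<^sup>+ w. ennreal (local_error (snd p) w) \<partial>std_gaussian) \<partial>\<zeta>)"
    by (intro nn_integral_cong)
      (simp add: split_beta nn_integral_add nn_integral_cmult N.emeasure_space_1[simplified])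
  also have "\<dots> = ennreal ((1 + m * g / 2) * q) * cost \<zeta>
      + ennreal (g\<^sup>2) * (\<integral>\<^sup>+ p. \<integral>\<^sup>+ w. ennreal (local_error (snd p) w) \<partial>std_gaussian \<partial>\<zeta>)"
    by (simp add: nn_integral_add nn_integral_cmult cost_def)
  also have "(\<integral>\<^sup>+ p. \<integral>\<^sup>+ w. ennreal (local_error (snd p) w) \<partial>std_gaussian \<partial>\<zeta>)
    = (\<integral>\<^sup>+ x. \<integral>\<^sup>+ w. ennreal (local_error x w) \<partial>std_gaussian \<partial>gibbs_measure U)"
    unfolding snd[symmetric] by (rule nn_integral_distr[symmetric]) measurable
  also have "\<dots> = ennreal error_bound"
    using local_error_finite by (simp add: error_bound_def)
  finally show ?thesis by (simp add: ennreal_mult error_bound_def)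
qed

definition contraction_factor :: "real \<Rightarrow> real" where
  "contraction_factor g = (if g * L\<^sup>2 \<le> m then 1 - m * g else 1 + g\<^sup>2 * L\<^sup>2)"

lemma gradient_step_contraction:
  assumes g: "0 < g"
  shows "(norm ((v - g *\<^sub>R gradU v) - (x - g *\<^sub>R gradU x)))\<^sup>2 \<le> contraction_factor g * (norm (v - x))\<^sup>2"
proof -
  define \<delta> G where "\<delta> = v - x" and "G = gradU v - gradU x"
  have "m * (norm \<delta>)\<^sup>2 \<le> \<delta> \<bullet> G"
  proof -
    have "U x \<ge> U v - gradU v \<bullet> \<delta> + (m / 2) * (norm \<delta>)\<^sup>2"
      using strong_convexity[of v x] by (simp add: \<delta>_def inner_diff_right)
    moreover have "U v \<ge> U x + gradU x \<bullet> \<delta> + (m / 2) * (norm \<delta>)\<^sup>2"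
      using strong_convexity[of x v] by (simp add: \<delta>_def norm_minus_commute)
    ultimately show ?thesis by (simp add: G_def inner_diff_right inner_commute)
  qed
  then have 1: "2 * g * (m * (norm \<delta>)\<^sup>2) \<le> 2 * g * (\<delta> \<bullet> G)"
    using g by (intro mult_left_mono) auto
  have "norm G \<le> L * norm \<delta>"
    using Lipschitz[of v x] by (simp add: G_def \<delta>_def)
  then have "(norm G)\<^sup>2 \<le> (L * norm \<delta>)\<^sup>2" by (intro power_mono) auto
  then have 2: "g\<^sup>2 * (norm G)\<^sup>2 \<le> g\<^sup>2 * (L\<^sup>2 * (norm \<delta>)\<^sup>2)"
    by (intro mult_left_mono) (auto simp: power_mult_distrib)
  have "(v - g *\<^sub>R gradU v) - (x - g *\<^sub>R gradU x) = \<delta> - g *\<^sub>R G"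
    by (simp add: \<delta>_def G_def algebra_simps)
  then have "(norm ((v - g *\<^sub>R gradU v) - (x - g *\<^sub>R gradU x)))\<^sup>2 = (norm \<delta>)\<^sup>2 - 2 * g * (\<delta> \<bullet> G) + g\<^sup>2 * (norm G)\<^sup>2"
    by (simp only: power2_norm_eq_inner) (simp add: inner_simps inner_commute power2_eq_square algebra_simps)
  also have "\<dots> \<le> (1 - 2 * (m * g) + g\<^sup>2 * L\<^sup>2) * (norm \<delta>)\<^sup>2"
    using 1 2 by (simp add: algebra_simps)
  also have "\<dots> \<le> contraction_factor g * (norm \<delta>)\<^sup>2"
  proof (intro mult_right_mono)
    have "g\<^sup>2 * L\<^sup>2 \<le> m * g" if "g * L\<^sup>2 \<le> m"
      using mult_left_mono[OF that, of g] g by (simp add: power2_eq_square ac_simps)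
    then show "1 - 2 * (m * g) + g\<^sup>2 * L\<^sup>2 \<le> contraction_factor g"
      using m_pos g by (simp add: contraction_factor_def mult.commute[of g m])
  qed simp
  finally show ?thesis by (simp add: \<delta>_def)
qed

lemma contraction_factor_nonneg:
  assumes "0 < g" "g \<le> 1 / (m + L)"
  shows "0 \<le> contraction_factor g"
proof -
  have "m * g \<le> (m + L) * g" using L_nonneg assms by (intro mult_right_mono) auto
  also have "\<dots> \<le> 1" using assms L_nonneg m_pos by (simp add: field_simps)
  finally show ?thesis by (simp add: contraction_factor_def)
qed

lemma return_coupling:
  "distr (gibbs_measure U) (borel \<Otimes>\<^sub>M borel) (\<lambda>y. (x, y)) \<in> couplings (return borel x) (gibbs_measure U)"
proof -
  interpret G: prob_space "gibbs_measure U" by (rule prob_space_gibbs_measure)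
  show ?thesis
    by (auto simp: couplings_def space_prob_algebra distr_distr comp_def G.distr_const
        intro!: G.prob_space_distr distr_id2)
qed

lemma return_coupling_cost_finite:
  "cost (distr (gibbs_measure U) (borel \<Otimes>\<^sub>M borel) (\<lambda>y. (x, y))) < \<infinity>"
proof -
  interpret G: prob_space "gibbs_measure U" by (rule prob_space_gibbs_measure)
  have "(dist x y)\<^sup>2 \<le> 1 + 64 * (norm x ^ 6 + norm y ^ 6)" for y
  proof -
    have "(dist x y)\<^sup>2 \<le> 1 + dist x y ^ 6"
    proof (cases "dist x y \<le> 1")
      case True
      then have "(dist x y)\<^sup>2 \<le> 1" by (simp add: power_le_one)
      then show ?thesis by (simp add: add_increasing2)
    next
      case False
      then have "(dist x y)\<^sup>2 \<le> dist x y ^ 6" by (intro power_increasing) auto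
      then show ?thesis by simp
    qed
    also have "dist x y ^ 6 \<le> (norm x + norm y) ^ 6"
      by (intro power_mono) (auto simp: dist_norm norm_triangle_ineq4)
    also have "\<dots> \<le> 64 * (norm x ^ 6 + norm y ^ 6)" by (rule power6_add_le) auto
    finally show ?thesis by simp
  qed
  then have "cost (distr (gibbs_measure U) (borel \<Otimes>\<^sub>M borel) (\<lambda>y. (x, y)))
    \<le> (\<integral>\<^sup>+ y. ennreal (1 + 64 * norm x ^ 6) + 64 * ennreal (norm y ^ 6) \<partial>gibbs_measure U)"
    unfolding cost_def by (subst nn_integral_distr)
      (auto intro!: nn_integral_mono ennreal_leI simp: distrib_left add.assoc
        simp flip: ennreal_numeral ennreal_mult ennreal_plus)
  also have "\<dots> = ennreal (1 + 64 * norm x ^ 6) + 64 * (\<integral>\<^sup>+ y. ennreal (norm y ^ 6) \<partial>gibbs_measure U)"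
    by (simp add: nn_integral_add nn_integral_cmult G.emeasure_space_1[simplified])
  also have "\<dots> < \<infinity>"
    using gibbs_norm_power6_finite by (simp add: ennreal_mult_less_top)
  finally show ?thesis .
qed

lemma measurable_euler_iter:
  assumes "\<And>k. 1 \<le> k \<Longrightarrow> 0 < \<gamma> k"
  shows "euler_iter gradU \<gamma> n \<in> borel \<rightarrow>\<^sub>M prob_algebra borel"
proof (induction n)
  case (Suc n)
  then show ?case
    using assms by (auto simp: kernel_comp_def intro!: measurable_bind_prob_space measurable_euler_kernel)
qed (simp add: measurable_return_prob_space)

primrec cost_bound :: "(nat \<Rightarrow> real) \<Rightarrow> real \<Rightarrow> nat \<Rightarrow> real" where
  "cost_bound \<gamma> c 0 = c"
| "cost_bound \<gamma> c (Suc n) = (1 + m * \<gamma> (Suc n) / 2) * contraction_factor (\<gamma> (Suc n)) * cost_bound \<gamma> c n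
     + (\<gamma> (Suc n))\<^sup>2 * error_bound"

lemma cost_bound_nonneg:
  assumes "0 \<le> c" "\<And>k. 1 \<le> k \<Longrightarrow> 0 < \<gamma> k" "\<And>k. 1 \<le> k \<Longrightarrow> \<gamma> k \<le> 1 / (m + L)"
  shows "0 \<le> cost_bound \<gamma> c n"
proof (induction n)
  case (Suc n)
  then show ?case
    using assms(2,3)[of "Suc n"] m_pos contraction_factor_nonneg[of "\<gamma> (Suc n)"]
    by (simp add: error_bound_def)
qed (simp add: assms)

lemma exists_coupling_euler_iter:
  fixes x :: "real ^ 'n"
  assumes pos: "\<And>k. 1 \<le> k \<Longrightarrow> 0 < \<gamma> k" and le: "\<And>k. 1 \<le> k \<Longrightarrow> \<gamma> k \<le> 1 / (m + L)"
  defines "c \<equiv> enn2real (cost (distr (gibbs_measure U) (borel \<Otimes>\<^sub>M borel) (\<lambda>y. (x, y))))"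
  shows "\<exists>\<zeta>\<in>couplings (euler_iter gradU \<gamma> n x) (gibbs_measure U). cost \<zeta> \<le> ennreal (cost_bound \<gamma> c n)"
proof (induction n)
  case 0
  show ?case
    using return_coupling return_coupling_cost_finite
    by (intro bexI) (auto simp: c_def)
next
  case (Suc n)
  let ?g = "\<gamma> (Suc n)"
  have g: "0 < ?g" "?g \<le> 1 / (m + L)" using pos le by auto
  obtain \<zeta> where \<zeta>: "\<zeta> \<in> couplings (euler_iter gradU \<gamma> n x) (gibbs_measure U)"
    and cost: "cost \<zeta> \<le> ennreal (cost_bound \<gamma> c n)"
    using Suc by blast
  have nonneg: "0 \<le> cost_bound \<gamma> c n"
    using pos le by (intro cost_bound_nonneg) (auto simp: c_def)
  have "cost (distr (\<zeta> \<Otimes>\<^sub>M noise) (borel \<Otimes>\<^sub>M borel) (coupled_step ?g))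
    \<le> ennreal ((1 + m * ?g / 2) * contraction_factor ?g) * cost \<zeta> + ennreal (?g\<^sup>2 * error_bound)"
    using g by (intro cost_coupled_step_le[OF _ _ \<zeta>] contraction_factor_nonneg gradient_step_contraction)
  also have "\<dots> \<le> ennreal ((1 + m * ?g / 2) * contraction_factor ?g) * ennreal (cost_bound \<gamma> c n) + ennreal (?g\<^sup>2 * error_bound)"
    using cost by (intro add_mono mult_left_mono) auto
  also have "\<dots> = ennreal (cost_bound \<gamma> c (Suc n))"
    using nonneg g m_pos contraction_factor_nonneg[OF g]
    by (simp add: error_bound_def flip: ennreal_mult ennreal_plus)
  finally show ?case
    using coupled_step_in_couplings[OF g(1) \<zeta>] by (auto simp: kernel_comp_def)
qed

lemma cost_bound_tendsto_0:
  assumes c: "0 \<le> c" and pos: "\<And>k. 1 \<le> k \<Longrightarrow> 0 < \<gamma> k" and le: "\<And>k. 1 \<le> k \<Longrightarrow> \<gamma> k \<le> 1 / (m + L)"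
    and lim: "\<gamma> \<longlonglongrightarrow> 0"
    and sum: "filterlim (\<lambda>n. \<Sum>k=1..n. \<gamma> k) at_top sequentially"
  shows "cost_bound \<gamma> c \<longlonglongrightarrow> 0"
proof -
  have "(\<lambda>n. \<gamma> (Suc n) * L\<^sup>2) \<longlonglongrightarrow> 0 * L\<^sup>2"
    by (intro tendsto_mult tendsto_const LIMSEQ_Suc lim)
  then have "\<forall>\<^sub>F n in sequentially. \<gamma> (Suc n) * L\<^sup>2 < m"
    using m_pos by (intro order_tendstoD(2)) auto
  then obtain N where N: "\<And>n. N \<le> n \<Longrightarrow> \<gamma> (Suc n) * L\<^sup>2 < m"
    by (auto simp: eventually_sequentially)
  have nonneg: "0 \<le> cost_bound \<gamma> c n" for n
    using c pos le by (intro cost_bound_nonneg) auto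
  show ?thesis
  proof (rule perturbed_contraction_tendsto_0[where N = N and c = "m / 2" and K = error_bound, OF _ _ _ _ _ _ lim sum])
    fix n assume n: "N \<le> n"
    have "(1 + m * \<gamma> (Suc n) / 2) * contraction_factor (\<gamma> (Suc n)) \<le> 1 - m / 2 * \<gamma> (Suc n)"
      using N[OF n] pos[of "Suc n"] m_pos by (simp add: contraction_factor_def algebra_simps)
    then show "cost_bound \<gamma> c (Suc n) \<le> (1 - m / 2 * \<gamma> (Suc n)) * cost_bound \<gamma> c n + error_bound * (\<gamma> (Suc n))\<^sup>2"
      using nonneg[of n] by (simp add: mult_right_mono)
    have "0 \<le> contraction_factor (\<gamma> (Suc n))"
      using pos le by (intro contraction_factor_nonneg) auto
    then show "m / 2 * \<gamma> (Suc n) \<le> 1"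
      using N[OF n] by (simp add: contraction_factor_def)
  qed (use pos m_pos nonneg in \<open>auto simp: error_bound_def\<close>)
qed

end

lemma wasserstein2_le:
  assumes "\<zeta> \<in> couplings \<mu> \<nu>" "0 \<le> a"
    and "(\<integral>\<^sup>+ z. ennreal ((dist (fst z) (snd z))\<^sup>2) \<partial>\<zeta>) \<le> ennreal a"
  shows "wasserstein2 \<mu> \<nu> \<le> ennreal (sqrt a)"
proof -
  define I where "I = (INF \<zeta>\<in>couplings \<mu> \<nu>. \<integral>\<^sup>+ z. ennreal ((dist (fst z) (snd z))\<^sup>2) \<partial>\<zeta>)"
  have le: "I \<le> ennreal a"
    unfolding I_def using assms by (meson INF_lower order_trans)
  then have "enn2real I \<le> a"
    using assms(2) enn2real_mono[OF le] by simp
  moreover have "I \<noteq> \<infinity>" using le by (auto simp: top_unique)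
  ultimately show ?thesis
    unfolding wasserstein2_def I_def[symmetric] by (simp add: ennreal_sqrt_def ennreal_leI)
qed

theorem corollary6:
  fixes U :: "real ^ 'n \<Rightarrow> real"
    and gradU :: "real ^ 'n \<Rightarrow> real ^ 'n"
    and L m :: real
    and \<gamma> :: "nat \<Rightarrow> real"
    and x :: "real ^ 'n"
  assumes gradient: "\<And>x. GDERIV U x :> gradU x"
    and gradient_continuous: "continuous_on UNIV gradU"
    and L_nonneg: "0 \<le> L"
    and m_pos: "0 < m"
    and gradient_Lipschitz: "\<And>x y. norm (gradU x - gradU y) \<le> L * norm (x - y)"
    and strongly_convex:
      "\<And>x y. U y \<ge> U x + gradU x \<bullet> (y - x) + (m / 2) * (norm (x - y))\<^sup>2"
    and step_pos: "\<And>k. 1 \<le> k \<Longrightarrow> 0 < \<gamma> k"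
    and step_nonincreasing: "\<And>j k. 1 \<le> j \<Longrightarrow> j \<le> k \<Longrightarrow> \<gamma> k \<le> \<gamma> j"
    and step_first: "\<gamma> 1 \<le> 1 / (m + L)"
    and step_lim: "\<gamma> \<longlonglongrightarrow> 0"
    and step_sum: "filterlim (\<lambda>n. \<Sum>k=1..n. \<gamma> k) at_top sequentially"
  shows "(\<lambda>n. wasserstein2 (return borel x \<bind> euler_iter gradU \<gamma> n) (gibbs_measure U)) \<longlonglongrightarrow> 0"
proof -
  have "isCont U z" for z
    using gradient[of z] unfolding gderiv_def by (rule has_derivative_continuous)
  then have U_continuous: "continuous_on UNIV U"
    by (simp add: continuous_on_eq_continuous_within)
  interpret strongly_convex_potential U gradU L m
    by unfold_locales (fact U_continuous gradient_continuous L_nonneg m_pos gradient_Lipschitz strongly_convex)+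
  have le: "\<gamma> k \<le> 1 / (m + L)" if "1 \<le> k" for k
    using step_nonincreasing[of 1 k] step_first that by simp
  define c where "c = enn2real (cost (distr (gibbs_measure U) (borel \<Otimes>\<^sub>M borel) (\<lambda>y. (x, y))))"
  have c: "0 \<le> c" by (simp add: c_def)
  have nonneg: "0 \<le> cost_bound \<gamma> c n" for n
    using c step_pos le by (intro cost_bound_nonneg) auto
  have bound: "wasserstein2 (return borel x \<bind> euler_iter gradU \<gamma> n) (gibbs_measure U)
    \<le> ennreal (sqrt (cost_bound \<gamma> c n))" for n
  proof -
    have "euler_iter gradU \<gamma> n \<in> borel \<rightarrow>\<^sub>M prob_algebra borel"
      using step_pos by (rule measurable_euler_iter)
    then have start: "return borel x \<bind> euler_iter gradU \<gamma> n = euler_iter gradU \<gamma> n x"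
      by (intro bind_return measurable_prob_algebraD) auto
    have "\<exists>\<zeta>\<in>couplings (euler_iter gradU \<gamma> n x) (gibbs_measure U).
        cost \<zeta> \<le> ennreal (cost_bound \<gamma> c n)"
      unfolding c_def using step_pos le by (rule exists_coupling_euler_iter)
    then obtain \<zeta> where \<zeta>: "\<zeta> \<in> couplings (euler_iter gradU \<gamma> n x) (gibbs_measure U)"
      and cost: "cost \<zeta> \<le> ennreal (cost_bound \<gamma> c n)" ..
    show ?thesis
      unfolding start by (rule wasserstein2_le[OF \<zeta> nonneg cost[unfolded cost_def]])
  qed
  have "cost_bound \<gamma> c \<longlonglongrightarrow> 0"
    using c step_pos le step_lim step_sum by (rule cost_bound_tendsto_0)
  then have "(\<lambda>n. ennreal (sqrt (cost_bound \<gamma> c n))) \<longlonglongrightarrow> ennreal (sqrt 0)"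
    by (intro tendsto_ennrealI tendsto_real_sqrt)
  then have lim: "(\<lambda>n. ennreal (sqrt (cost_bound \<gamma> c n))) \<longlonglongrightarrow> 0" by simp
  show ?thesis
    by (rule tendsto_sandwich[OF _ _ tendsto_const lim]) (simp_all add: bound)
qed

end
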